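(* Let $\Omega$, $B$, $\phi$, $\epsilon>0$, $D$ and $d$ be as in the context. Consider the bilinear form on $H^1_0(B)$ $$a(u,v) := \int_B D\,\nabla(\phi u)\cdot\left[\nabla(\phi v)+v\nabla\phi\right]+\frac{D}{\epsilon^{2}}(1-\phi)^2\,uv+\frac{D}{4}|\nabla\phi|^2\,uv\;dx .$$ Then $a$ is coercive: there is a constant $C>0$ such that $a(u,u)\ge C\|u\|^2$ for all $u\in H^1_0(B)$, with respect to the norm $$\|u\|^2 := \int_B \phi^2|\nabla u|^2+\epsilon^{-2}(1-\phi)^2|u|^2\;dx .$$
   Context: $\Omega\subset\mathbb{R}^n$ is a sufficiently smooth bounded domain, and $B\supset\Omega$ is a larger bounded domain. $r$ is the signed distance function of $\Omega$ (negative in $\Omega$, positive outside, $|\nabla r|=1$ almost everywhere). For a fixed parameter $\epsilon>0$ the phase-field function is $$\phi(x)=\tfrac12\left(1-\tanh\left(\tfrac{3r(x)}{\epsilon}\right)\right),\quad x\in B,$$ so $\phi$ takes values in $(0,1)$ and $\nabla\phi=-\frac{6}{\epsilon}\phi(1-\phi)\nabla r$. $D:B\to\mathbb{R}$ is a bounded scalar function with $D(x)\ge d>0$ for a constant $d$. *)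

theory Defs
  imports "HOL-Analysis.Analysis"
begin

definition bounded_domain :: "'a::euclidean_space set \<Rightarrow> bool" where
  "bounded_domain S \<longleftrightarrow> open S \<and> connected S \<and> S \<noteq> {} \<and> bounded S"

text \<open>\<open>C_k k S f\<close>: \<open>f\<close> is of class \<open>C\<^sup>k\<close> on the open set \<open>S\<close>; partial derivatives are the
  values of the Frechet derivative on the standard basis vectors.\<close>

fun C_k :: "nat \<Rightarrow> 'a::euclidean_space set \<Rightarrow> ('a \<Rightarrow> real) \<Rightarrow> bool" where
  "C_k 0 S f \<longleftrightarrow> continuous_on S f"
| "C_k (Suc k) S f \<longleftrightarrow>
     (\<forall>x\<in>S. f differentiable (at x)) \<and>
     (\<forall>i\<in>Basis. C_k k S (\<lambda>x. frechet_derivative f (at x) i))"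

text \<open>\<open>C\<^sup>k\<close> boundary, by local defining functions: near each boundary point the set is a strict
  sublevel set of a \<open>C\<^sup>k\<close> function without critical points. For \<open>k \<ge> 1\<close> this is equivalent, by the
  implicit function theorem, to being locally the region on one side of the graph of a
  \<open>C\<^sup>k\<close> function.\<close>

definition C_k_boundary :: "nat \<Rightarrow> 'a::euclidean_space set \<Rightarrow> bool" where
  "C_k_boundary k \<Omega> \<longleftrightarrow>
     (\<forall>p\<in>frontier \<Omega>. \<exists>U \<rho>. open U \<and> p \<in> U \<and> C_k k U \<rho> \<and>
        (\<forall>x\<in>U. frechet_derivative \<rho> (at x) \<noteq> (\<lambda>h. 0)) \<and>
        \<Omega> \<inter> U = {x \<in> U. \<rho> x < 0})"

definition signed_dist :: "'a::euclidean_space set \<Rightarrow> 'a \<Rightarrow> real" where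
  "signed_dist \<Omega> x =
     (if x \<in> \<Omega> then - infdist x (frontier \<Omega>) else infdist x (frontier \<Omega>))"

definition phase_field :: "'a::euclidean_space set \<Rightarrow> real \<Rightarrow> 'a \<Rightarrow> real" where
  "phase_field \<Omega> \<epsilon> x = 1 / 2 * (1 - tanh (3 * signed_dist \<Omega> x / \<epsilon>))"

text \<open>The elements of \<open>C\<^sub>c\<^sup>\<infinity>(B)\<close>, extended by zero to the whole space.\<close>

definition test_functions :: "'a::euclidean_space set \<Rightarrow> ('a \<Rightarrow> real) set" where
  "test_functions B =
     {\<psi>. (\<forall>k. C_k k UNIV \<psi>) \<and> compact (closure {x. \<psi> x \<noteq> 0}) \<and> closure {x. \<psi> x \<noteq> 0} \<subseteq> B}"

definition locally_integrable ::
  "'a::euclidean_space set \<Rightarrow> ('a \<Rightarrow> 'b::euclidean_space) \<Rightarrow> bool" where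
  "locally_integrable B f \<longleftrightarrow> (\<forall>K. compact K \<and> K \<subseteq> B \<longrightarrow> set_integrable lebesgue K f)"

definition has_weak_gradient ::
  "'a::euclidean_space set \<Rightarrow> ('a \<Rightarrow> real) \<Rightarrow> ('a \<Rightarrow> 'a) \<Rightarrow> bool" where
  "has_weak_gradient B u g \<longleftrightarrow>
     locally_integrable B u \<and> locally_integrable B g \<and>
     (\<forall>\<psi>\<in>test_functions B. \<forall>i\<in>Basis.
        (LINT x:B|lebesgue. u x * frechet_derivative \<psi> (at x) i) =
        - (LINT x:B|lebesgue. (g x \<bullet> i) * \<psi> x))"

text \<open>A representative of the weak gradient. It is determined up to null sets of \<open>B\<close>, and it is
  meaningful only if \<open>u\<close> has a weak gradient on \<open>B\<close>.\<close>

definition weak_grad ::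
  "'a::euclidean_space set \<Rightarrow> ('a \<Rightarrow> real) \<Rightarrow> 'a \<Rightarrow> 'a" where
  "weak_grad B u = (SOME g. has_weak_gradient B u g)"

text \<open>Sobolev functions are represented by total functions of which only the values on \<open>B\<close>
  matter, and which are not identified when they agree almost everywhere.\<close>

definition H1 :: "'a::euclidean_space set \<Rightarrow> ('a \<Rightarrow> real) set" where
  "H1 B =
     {u. u \<in> borel_measurable (lebesgue_on B) \<and>
         set_integrable lebesgue B (\<lambda>x. (u x)\<^sup>2) \<and>
         (\<exists>g. has_weak_gradient B u g) \<and>
         set_integrable lebesgue B (\<lambda>x. (norm (weak_grad B u x))\<^sup>2)}"

definition H1_norm :: "'a::euclidean_space set \<Rightarrow> ('a \<Rightarrow> real) \<Rightarrow> real" where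
  "H1_norm B u = sqrt (LINT x:B|lebesgue. (u x)\<^sup>2 + (norm (weak_grad B u x))\<^sup>2)"

text \<open>The closure of \<open>C\<^sub>c\<^sup>\<infinity>(B)\<close> in \<open>H\<^sup>1(B)\<close>.\<close>

definition H1_0 :: "'a::euclidean_space set \<Rightarrow> ('a \<Rightarrow> real) set" where
  "H1_0 B =
     {u \<in> H1 B. \<exists>\<psi>. (\<forall>k::nat. \<psi> k \<in> test_functions B) \<and>
        (\<lambda>k. H1_norm B (\<lambda>x. u x - \<psi> k x)) \<longlonglongrightarrow> 0}"

definition pf_form ::
  "'a::euclidean_space set \<Rightarrow> ('a \<Rightarrow> real) \<Rightarrow> ('a \<Rightarrow> real) \<Rightarrow> real \<Rightarrow>
   ('a \<Rightarrow> real) \<Rightarrow> ('a \<Rightarrow> real) \<Rightarrow> real" where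
  "pf_form B D \<phi> \<epsilon> u v =
     (LINT x:B|lebesgue.
        D x * (weak_grad B (\<lambda>y. \<phi> y * u y) x \<bullet>
               (weak_grad B (\<lambda>y. \<phi> y * v y) x + v x *\<^sub>R weak_grad B \<phi> x))
        + D x / \<epsilon>\<^sup>2 * (1 - \<phi> x)\<^sup>2 * u x * v x
        + D x / 4 * (norm (weak_grad B \<phi> x))\<^sup>2 * u x * v x)"

definition pf_norm ::
  "'a::euclidean_space set \<Rightarrow> ('a \<Rightarrow> real) \<Rightarrow> real \<Rightarrow> ('a \<Rightarrow> real) \<Rightarrow> real" where
  "pf_norm B \<phi> \<epsilon> u =
     sqrt (LINT x:B|lebesgue.
             (\<phi> x)\<^sup>2 * (norm (weak_grad B u x))\<^sup>2 + 1 / \<epsilon>\<^sup>2 * (1 - \<phi> x)\<^sup>2 * \<bar>u x\<bar>\<^sup>2)"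

end

theory Submission
  imports Defs
begin

text \<open>Write \<open>w\<close> for the weak gradient of \<open>u\<close> and \<open>p\<close> for that of \<open>\<phi>\<close>. Completing the square turns the
  integrand of \<open>a(u,u)\<close> into \<open>D (\<bar>\<phi> w + 3/2 u p\<bar>\<^sup>2 + Y)\<close> with \<open>Y = \<epsilon>\<^sup>-\<^sup>2 (1 - \<phi>)\<^sup>2 u\<^sup>2\<close>. Since
  \<open>\<bar>p\<bar> = 6/\<epsilon> \<phi> (1 - \<phi>)\<close>, the cross term satisfies \<open>\<bar>u p\<bar>\<^sup>2 \<le> 36 Y\<close> and can be absorbed, which gives
  the constant \<open>d / 163\<close>. What has to be justified is the calculus of weak gradients behind this:
  they are unique almost everywhere; the Lipschitz function \<open>\<phi>\<close> has its classical gradient as weak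
  gradient, by passing to the limit in difference quotients; and \<open>\<nabla>(\<phi> u) = \<phi> w + u p\<close>, by
  approximating \<open>u\<close> with test functions \<open>\<psi>\<close>, for which the identity results from testing the weak
  gradient of \<open>\<phi>\<close> with \<open>\<psi> \<eta>\<close>.\<close>

subsection \<open>Smooth bump functions\<close>

text \<open>The number 3/2 comes from the form itself: with X = \<open>\<phi>\<close> w + u p its
  first term is X . (X + u p), and the term with \<open>D / 4\<close> is exactly what completes this
  to the square of X + (u/2) p. Two features of the encoding shape the proof.
  \<open>weak_grad\<close> is an arbitrary choice, so it can be computed only almost everywhere and
  only through uniqueness; uniqueness needs explicit test functions that approximate indicators of
  boxes. And the Bochner integral of a non-integrable function is 0, so integrals may be split or
  compared only after integrability is shown; for a(u,u) this is where the upper bound of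
  \<open>D\<close> enters. A gradient that exists almost everywhere need not be a weak gradient: the
  distributional derivative could have a singular part. Lipschitz continuity excludes this by
  bounding the difference quotients. Membership in \<open>H1_0\<close> supplies the approximating
  test functions without mollification, and since \<open>B\<close> is bounded, convergence in
  \<open>H1_norm\<close> implies convergence in L1.\<close>

lemma C_k_Suc_imp: "C_k (Suc k) S f \<Longrightarrow> C_k k S f"
proof (induction k arbitrary: f)
  case 0
  then show ?case
    by (auto intro!: continuous_at_imp_continuous_on differentiable_imp_continuous_within)
qed auto

lemma C_k_const: "C_k k UNIV (\<lambda>x. c)"
  by (induction k arbitrary: c) auto

lemma C_k_inner: "C_k k UNIV (\<lambda>x. x \<bullet> v)"
proof (cases k)
  case (Suc m)
  have "frechet_derivative (\<lambda>x. x \<bullet> v) (at x) = (\<lambda>h. h \<bullet> v)" for x :: 'a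
    by (intro frechet_derivative_at[symmetric] bounded_linear_imp_has_derivative
        bounded_linear_inner_left)
  then show ?thesis
    using Suc by (auto intro!: C_k_const bounded_linear_imp_differentiable bounded_linear_inner_left)
qed (auto intro!: continuous_intros)

lemma C_k_add:
  assumes "C_k k UNIV f" "C_k k UNIV g"
  shows "C_k k UNIV (\<lambda>x. f x + g x)"
  using assms
proof (induction k arbitrary: f g)
  case (Suc k)
  then have d: "frechet_derivative (\<lambda>x. f x + g x) (at x) =
      (\<lambda>h. frechet_derivative f (at x) h + frechet_derivative g (at x) h)" for x
    by (intro frechet_derivative_at[symmetric] has_derivative_add)
      (auto simp: frechet_derivative_works[symmetric])
  show ?case
    using Suc by (auto simp: d)
qed (auto intro!: continuous_intros)

lemma C_k_mult:
  assumes "C_k k UNIV f" "C_k k UNIV g"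
  shows "C_k k UNIV (\<lambda>x. f x * g x)"
  using assms
proof (induction k arbitrary: f g)
  case (Suc k)
  then have d: "frechet_derivative (\<lambda>x. f x * g x) (at x) =
      (\<lambda>h. f x * frechet_derivative g (at x) h + frechet_derivative f (at x) h * g x)" for x
    by (intro frechet_derivative_at[symmetric] has_derivative_mult)
      (auto simp: frechet_derivative_works[symmetric])
  \<comment> \<open>The Leibniz rule leaves \<open>f\<close> and \<open>g\<close> undifferentiated
    in one factor each, so both are also needed as \<open>C_k k\<close>, one order below what is
    given.\<close>
  show ?case
    using Suc C_k_Suc_imp[OF Suc.prems(1)] C_k_Suc_imp[OF Suc.prems(2)]
    by (auto simp: d intro!: C_k_add)
qed (auto intro!: continuous_intros)

lemma C_k_prod:
  assumes "\<And>i. i \<in> I \<Longrightarrow> C_k k UNIV (f i)"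
  shows "C_k k UNIV (\<lambda>x. \<Prod>i\<in>I. f i x)"
  using assms
  by (induction I rule: infinite_finite_induct) (auto intro!: C_k_const C_k_mult)

text \<open>A whole sequence of successive derivatives makes the induction close: a partial
  derivative of \<open>F n\<close> after \<open>q\<close> is a partial derivative of
  \<open>q\<close> times \<open>F (Suc n)\<close> after \<open>q\<close>, a product of the same kind
  with \<open>n\<close> shifted.\<close>

lemma C_k_compose:
  fixes F :: "nat \<Rightarrow> real \<Rightarrow> real"
  assumes F: "\<And>n t. (F n has_real_derivative F (Suc n) t) (at t)"
    and q: "\<And>k. C_k k UNIV q"
  shows "C_k k UNIV (\<lambda>x. F n (q x))"
proof (induction k arbitrary: n)
  case 0
  have "continuous_on UNIV (F n)"
    using F by (meson DERIV_continuous continuous_at_imp_continuous_on)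
  then show ?case
    using q[of 0] by (auto intro: continuous_on_compose2)
next
  case (Suc k)
  have "((\<lambda>x. F n (q x)) has_derivative
      (\<lambda>h. frechet_derivative q (at x) h * F (Suc n) (q x))) (at x)" for x
    using has_derivative_compose[of q "frechet_derivative q (at x)" x UNIV "F n"]
      F[of n "q x"] q[of "Suc 0"]
    by (auto simp: has_field_derivative_def frechet_derivative_works[symmetric] mult.commute)
  note d = this
  show ?case
    using q[of "Suc k"] Suc d
    by (auto simp: differentiable_def C_k_mult frechet_derivative_at[OF d, symmetric])
qed

section \<open>The function exp(-1/s), flat at 0, and its derivatives\<close>

lemma poly_times_exp_minus_tendsto_0:
  "((\<lambda>y::real. poly p y * exp (- y)) \<longlongrightarrow> 0) at_top"
proof -
  have "((\<lambda>y. \<Sum>i\<le>degree p. coeff p i * (y ^ i / exp y)) \<longlongrightarrow> (\<Sum>i\<le>degree p. coeff p i * 0)) at_top"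
    by (intro tendsto_intros tendsto_power_div_exp_0)
  then show ?thesis
    by (simp add: poly_altdef exp_minus sum_distrib_right divide_inverse mult.assoc)
qed

text \<open>For p = 1 this is the classical smooth function that is not analytic at 0. The
  polynomial in 1/s makes room for its derivatives.\<close>

definition flat_exp :: "real poly \<Rightarrow> real \<Rightarrow> real" where
  "flat_exp p s = (if s > 0 then poly p (inverse s) * exp (- inverse s) else 0)"

text \<open>Since \<open>d/ds p(1/s) e\<^sup>-\<^sup>1\<^sup>/\<^sup>s = s\<^sup>-\<^sup>2 (p - p')(1/s) e\<^sup>-\<^sup>1\<^sup>/\<^sup>s\<close>, the family is closed under differentiation.\<close>

definition flat_exp_step :: "real poly \<Rightarrow> real poly" where
  "flat_exp_step p = [:0, 0, 1:] * (p - pderiv p)"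

lemma flat_exp_deriv: "(flat_exp p has_real_derivative flat_exp (flat_exp_step p) t) (at t)"
proof -
  consider "t > 0" | "t < 0" | "t = 0" by linarith
  then show ?thesis
  proof cases
    case 1
    have "((\<lambda>s. poly p (inverse s) * exp (- inverse s)) has_real_derivative
        flat_exp (flat_exp_step p) t) (at t)"
      using 1 by (auto intro!: derivative_eq_intros DERIV_chain'[OF _ poly_DERIV]
          simp: flat_exp_def flat_exp_step_def field_simps power2_eq_square)
    then show ?thesis
      by (rule has_field_derivative_transform_within_open[of _ _ _ "{0<..}"])
        (use 1 in \<open>auto simp: flat_exp_def\<close>)
  next
    case 2
    have "((\<lambda>s. 0) has_real_derivative flat_exp (flat_exp_step p) t) (at t)"
      using 2 by (auto simp: flat_exp_def)
    then show ?thesis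
      by (rule has_field_derivative_transform_within_open[of _ _ _ "{..<0}"])
        (use 2 in \<open>auto simp: flat_exp_def\<close>)
  next
    case 3
    \<comment> \<open>Dividing by s in the difference quotient at 0 multiplies the polynomial in y =
      1/s by y, hence the factor \<open>[:0, 1:]\<close>; the exponential still wins as y tends to
      infinity.\<close>
    have "((\<lambda>s. poly ([:0, 1:] * p) (inverse s) * exp (- inverse s)) \<longlongrightarrow> 0) (at_right 0)"
      by (rule filterlim_compose[OF poly_times_exp_minus_tendsto_0 filterlim_inverse_at_top_right])
    then have r: "((\<lambda>s. flat_exp p s / s) \<longlongrightarrow> 0) (at_right 0)"
      by (rule Lim_transform_eventually)
        (auto simp: eventually_at_right_field flat_exp_def field_simps intro!: exI[of _ 1])
    have l: "((\<lambda>s. flat_exp p s / s) \<longlongrightarrow> 0) (at_left 0)"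
      by (rule Lim_transform_eventually[OF tendsto_const])
        (auto simp: eventually_at_left_field flat_exp_def intro!: exI[of _ "-1"])
    have "((\<lambda>s. flat_exp p s / s) \<longlongrightarrow> 0) (at 0)"
      using l r by (simp add: filterlim_split_at)
    then show ?thesis
      using 3 by (simp add: has_field_derivative_iff flat_exp_def)
  qed
qed

lemma C_k_flat_exp:
  assumes "\<And>k. C_k k UNIV q"
  shows "C_k k UNIV (\<lambda>x. flat_exp 1 (q x))"
  using C_k_compose[of "\<lambda>n. flat_exp ((flat_exp_step ^^ n) 1)" q k 0] flat_exp_deriv assms
  by auto

lemma flat_exp_1: "0 \<le> flat_exp 1 s" "flat_exp 1 s \<le> 1" "flat_exp 1 s \<noteq> 0 \<longleftrightarrow> s > 0"
  by (auto simp: flat_exp_def)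

text \<open>Stretching the argument leaves the sign, and so the zero set, unchanged, while
  exp(-1/((n+1) s)) rises to 1 for every positive s.\<close>

lemma flat_exp_scaled_tendsto:
  "(\<lambda>n. flat_exp 1 (real (Suc n) * s)) \<longlonglongrightarrow> (if s > 0 then 1 else 0)"
proof (cases "s > 0")
  case True
  have "(\<lambda>n. exp (- (inverse (real (Suc n)) * inverse s))) \<longlonglongrightarrow> exp (- (0 * inverse s))"
    by (intro tendsto_intros LIMSEQ_inverse_real_of_nat)
  then show ?thesis
    using True by (simp add: flat_exp_def zero_less_mult_iff)
qed (auto simp: flat_exp_def zero_less_mult_iff)

text \<open>In each coordinate the quadratic (x_i - a_i)(b_i - x_i) is positive exactly between a_i
  and b_i, because a_i < b_i forbids two negative factors. The product over the coordinates of the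
  stretched flat functions of these quadratics is smooth and nonzero exactly on the box.\<close>

lemma test_functions_tendsto_indicator_box:
  fixes a b :: "'a::euclidean_space"
  assumes ne: "box a b \<noteq> {}" and sub: "cbox a b \<subseteq> B"
  obtains \<psi> :: "nat \<Rightarrow> 'a \<Rightarrow> real"
  where "\<And>n. \<psi> n \<in> test_functions B" "\<And>n x. 0 \<le> \<psi> n x" "\<And>n x. \<psi> n x \<le> 1"
    "\<And>n x. \<psi> n x \<noteq> 0 \<longleftrightarrow> x \<in> box a b" "\<And>x. (\<lambda>n. \<psi> n x) \<longlonglongrightarrow> indicator (box a b) x"
proof
  define q where "q n i x = real (Suc n) * ((x \<bullet> i - a \<bullet> i) * (b \<bullet> i - x \<bullet> i))" for n and i x :: 'a
  define \<psi> where "\<psi> n x = (\<Prod>i\<in>Basis. flat_exp 1 (q n i x))" for n x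
  have ab: "a \<bullet> i < b \<bullet> i" if "i \<in> Basis" for i
    using ne that by (auto simp: box_ne_empty)
  have pos: "(x \<bullet> i - a \<bullet> i) * (b \<bullet> i - x \<bullet> i) > 0 \<longleftrightarrow> a \<bullet> i < x \<bullet> i \<and> x \<bullet> i < b \<bullet> i"
    if "i \<in> Basis" for i x
    using ab[OF that] by (auto simp: zero_less_mult_iff)
  have qpos: "q n i x > 0 \<longleftrightarrow> a \<bullet> i < x \<bullet> i \<and> x \<bullet> i < b \<bullet> i" if "i \<in> Basis" for n i x
    using pos[OF that, of x] unfolding q_def by (simp add: zero_less_mult_iff)
  \<comment> \<open>The same quadratic without subtraction, in the shape that the closure rules for
    sums, products and constants match.\<close>
  have q_alt: "q n i x = real (Suc n) * ((x \<bullet> i + - (a \<bullet> i)) * (b \<bullet> i + (- 1) * (x \<bullet> i)))" for n i x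
    by (simp add: q_def)
  have smooth_q: "C_k k UNIV (q n i)" for k n i
    unfolding q_alt[abs_def] by (intro C_k_mult C_k_add C_k_const C_k_inner)
  show nz: "\<psi> n x \<noteq> 0 \<longleftrightarrow> x \<in> box a b" for n x
    by (auto simp: \<psi>_def mem_box qpos flat_exp_1(3))
  \<comment> \<open>A nonempty box has the full closed box as closure, so the support reaches the
    faces; this is why \<open>cbox a b\<close> has to lie in \<open>B\<close>.\<close>
  have cl: "closure {x. \<psi> n x \<noteq> 0} = cbox a b" for n
    using ne by (simp add: nz closure_box)
  show "\<psi> n \<in> test_functions B" for n
    using sub unfolding test_functions_def mem_Collect_eq cl
    by (auto simp: \<psi>_def[abs_def] intro!: C_k_prod C_k_flat_exp smooth_q)
  show "0 \<le> \<psi> n x" "\<psi> n x \<le> 1" for n x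
    by (auto simp: \<psi>_def flat_exp_1 intro!: prod_nonneg prod_le_1)
  show "(\<lambda>n. \<psi> n x) \<longlonglongrightarrow> indicator (box a b) x" for x
  proof -
    have "(\<lambda>n. \<psi> n x) \<longlonglongrightarrow> (\<Prod>i\<in>Basis. if (x \<bullet> i - a \<bullet> i) * (b \<bullet> i - x \<bullet> i) > 0 then 1 else 0)"
      unfolding \<psi>_def q_def by (intro tendsto_prod flat_exp_scaled_tendsto)
    also have "(\<Prod>i\<in>Basis. if (x \<bullet> i - a \<bullet> i) * (b \<bullet> i - x \<bullet> i) > 0 then 1 else 0) =
        (indicator (box a b) x :: real)"
      by (auto simp: indicator_def mem_box pos intro!: prod.neutral)
    finally show ?thesis .
  qed
qed

subsection \<open>Uniqueness of weak gradients\<close>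

lemma test_functions_smooth: "\<psi> \<in> test_functions B \<Longrightarrow> C_k k UNIV \<psi>"
  by (simp add: test_functions_def)

lemma test_functions_differentiable: "\<psi> \<in> test_functions B \<Longrightarrow> \<psi> differentiable (at x)"
  using test_functions_smooth[of \<psi> B "Suc 0"] by simp

lemma test_functions_continuous: "\<psi> \<in> test_functions B \<Longrightarrow> continuous_on UNIV \<psi>"
  using test_functions_smooth[of \<psi> B 0] by simp

lemma test_functions_support:
  assumes "\<psi> \<in> test_functions B"
  obtains K where "compact K" "K \<subseteq> B" "\<And>x. x \<notin> K \<Longrightarrow> \<psi> x = 0"
  using assms closure_subset[of "{x. \<psi> x \<noteq> 0}"] unfolding test_functions_def by blast

lemma test_functions_eq_0: "\<psi> \<in> test_functions B \<Longrightarrow> x \<notin> B \<Longrightarrow> \<psi> x = 0"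
  by (metis test_functions_support subsetD)

lemma test_functionsI:
  assumes "\<And>k. C_k k UNIV \<psi>" "compact K" "K \<subseteq> B" "\<And>x. x \<notin> K \<Longrightarrow> \<psi> x = 0"
  shows "\<psi> \<in> test_functions B"
proof -
  have "closure {x. \<psi> x \<noteq> 0} \<subseteq> K"
    using assms by (intro closure_minimal) (auto simp: compact_imp_closed)
  moreover from this have "compact (closure {x. \<psi> x \<noteq> 0})"
    using assms(2) by (metis closed_closure compact_Int_closed inf.absorb_iff2)
  ultimately show ?thesis
    using assms by (auto simp: test_functions_def)
qed

lemma test_functions_mult:
  assumes "\<psi> \<in> test_functions B" "\<And>k. C_k k UNIV f"
  shows "(\<lambda>x. f x * \<psi> x) \<in> test_functions B"
  using assms by (metis (mono_tags, lifting) C_k_mult mult_zero_right test_functionsI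
      test_functions_smooth test_functions_support)

lemma test_functions_partial:
  assumes \<psi>: "\<psi> \<in> test_functions B" and i: "i \<in> Basis"
  shows "(\<lambda>x. frechet_derivative \<psi> (at x) i) \<in> test_functions B"
proof -
  obtain K where K: "compact K" "K \<subseteq> B" "\<And>x. x \<notin> K \<Longrightarrow> \<psi> x = 0"
    by (rule test_functions_support[OF \<psi>]) blast
  show ?thesis
  proof (rule test_functionsI[OF _ K(1,2)])
    show "C_k k UNIV (\<lambda>x. frechet_derivative \<psi> (at x) i)" for k
      using test_functions_smooth[OF \<psi>, of "Suc k"] i by simp
    show "frechet_derivative \<psi> (at x) i = 0" if "x \<notin> K" for x
    proof -
      have "(\<psi> has_derivative (\<lambda>h. 0)) (at x)"
        by (rule has_derivative_transform_within_open[of "\<lambda>x. 0" _ _ _ "- K"])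
          (use that K in \<open>auto simp: compact_imp_closed open_Compl\<close>)
      then show ?thesis
        by (simp add: frechet_derivative_at[symmetric])
    qed
  qed
qed

lemma test_functions_bounded:
  assumes \<psi>: "\<psi> \<in> test_functions B"
  obtains M where "M > 0" "\<And>x. \<bar>\<psi> x\<bar> \<le> M"
proof -
  obtain K where K: "compact K" "\<And>x. x \<notin> K \<Longrightarrow> \<psi> x = 0"
    using test_functions_support[OF \<psi>] by metis
  have "bounded (\<psi> ` K)"
    using K continuous_on_subset[OF test_functions_continuous[OF \<psi>]]
    by (auto intro!: compact_imp_bounded compact_continuous_image)
  then obtain M where M: "M > 0" "\<forall>y\<in>\<psi> ` K. norm y \<le> M"
    unfolding bounded_pos by blast
  have "\<bar>\<psi> x\<bar> \<le> M" for x
    using M K(2)[of x] by (cases "x \<in> K") auto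
  with M show thesis
    using that by blast
qed

section \<open>Measurability, and integrability against test functions\<close>

lemma borel_measurable_test_functions:
  "\<psi> \<in> test_functions B \<Longrightarrow> \<psi> \<in> borel_measurable borel"
  by (simp add: borel_measurable_continuous_onI test_functions_continuous)

lemma borel_measurable_lebesgue_onI:
  "f \<in> borel_measurable borel \<Longrightarrow> f \<in> borel_measurable (lebesgue_on S)"
  by (simp add: measurable_completion measurable_restrict_space1)

text \<open>Local integrability speaks of compact sets only. An open set is a countable union of
  closed boxes, on each of which the function is integrable and so measurable; the pieces are
  glued.\<close>

lemma locally_integrable_imp_measurable:
  assumes "open B" "locally_integrable B f"
  shows "f \<in> borel_measurable (lebesgue_on B)"
proof -
  obtain \<D> where D: "countable \<D>" "\<D> \<subseteq> Pow B" "\<And>X. X \<in> \<D> \<Longrightarrow> \<exists>a b. X = cbox a b" "\<Union>\<D> = B"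
    using open_countable_Union_open_cbox[OF assms(1)] by metis
  show ?thesis
  proof (rule measurable_piecewise_restrict[OF D(1)])
    fix X assume X: "X \<in> \<D>"
    then obtain a b where ab: "X = cbox a b" "X \<subseteq> B"
      using D by blast
    then show "X \<inter> space (lebesgue_on B) \<in> sets (lebesgue_on B)"
      using assms(1) by (simp add: sets_restrict_space_iff inf.absorb1)
    have "integrable (lebesgue_on X) f"
      using assms(2) ab by (auto simp: locally_integrable_def set_integrable_def integrable_restrict_space)
    then show "f \<in> restrict_space (lebesgue_on B) X \<rightarrow>\<^sub>M borel"
      using assms(1) ab by (simp add: restrict_restrict_space inf.absorb2 borel_measurable_integrable)
  qed (use D in auto)
qed

text \<open>A test function is bounded and lives on a compact \<open>K\<close>, so the product is
  dominated by a multiple of \<open>f\<close> cut off to \<open>K\<close>. This is what permits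
  splitting the integrals in the definition of a weak gradient, none of which takes the default
  value 0.\<close>

lemma integrable_test_scaleR:
  fixes f :: "'a::euclidean_space \<Rightarrow> 'b::euclidean_space"
  assumes B: "open B" and f: "locally_integrable B f" and \<psi>: "\<psi> \<in> test_functions B"
  shows "integrable (lebesgue_on B) (\<lambda>x. \<psi> x *\<^sub>R f x)"
proof -
  obtain K where K: "compact K" "K \<subseteq> B" "\<And>x. x \<notin> K \<Longrightarrow> \<psi> x = 0"
    by (rule test_functions_support[OF \<psi>]) blast
  obtain M where M: "M > 0" "\<And>x. \<bar>\<psi> x\<bar> \<le> M"
    by (rule test_functions_bounded[OF \<psi>]) blast
  note [measurable] = locally_integrable_imp_measurable[OF B f]
    borel_measurable_lebesgue_onI[OF borel_measurable_test_functions[OF \<psi>]]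
  have "integrable lebesgue (\<lambda>x. indicator K x *\<^sub>R f x)"
    using f K by (simp add: locally_integrable_def set_integrable_def)
  then have "integrable lebesgue (\<lambda>x. indicator B x *\<^sub>R (indicator K x *\<^sub>R f x))"
    by (rule back_subst[where P="integrable lebesgue"]) (use K(2) in \<open>auto simp: indicator_def fun_eq_iff\<close>)
  then have "integrable (lebesgue_on B) (\<lambda>x. indicator K x *\<^sub>R f x)"
    using B by (simp add: integrable_restrict_space)
  then have "integrable (lebesgue_on B) (\<lambda>x. M *\<^sub>R (indicator K x *\<^sub>R f x))"
    by (rule integrable_scaleR_right)
  then show ?thesis
  proof (rule Bochner_Integration.integrable_bound)
    show "AE x in lebesgue_on B. norm (\<psi> x *\<^sub>R f x) \<le> norm (M *\<^sub>R (indicator K x *\<^sub>R f x))"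
    proof (rule AE_I2)
      fix x show "norm (\<psi> x *\<^sub>R f x) \<le> norm (M *\<^sub>R (indicator K x *\<^sub>R f x))"
        using M K(3)[of x] by (cases "x \<in> K") (auto intro: mult_right_mono)
    qed
  qed measurable
qed

lemma set_lebesgue_integral_lebesgue_on:
  fixes f :: "'a::euclidean_space \<Rightarrow> 'b::{banach, second_countable_topology}"
  shows "open B \<Longrightarrow> (LINT x:B|lebesgue. f x) = integral\<^sup>L (lebesgue_on B) f"
  by (simp add: set_lebesgue_integral_def integral_restrict_space)

lemma set_integrable_lebesgue_on:
  fixes f :: "'a::euclidean_space \<Rightarrow> 'b::{banach, second_countable_topology}"
  shows "open B \<Longrightarrow> set_integrable lebesgue B f \<longleftrightarrow> integrable (lebesgue_on B) f"
  by (simp add: set_integrable_def integrable_restrict_space)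

section \<open>The fundamental lemma of the calculus of variations\<close>

lemma integral_box_eq_0:
  fixes f :: "'a::euclidean_space \<Rightarrow> real"
  assumes B: "open B" and f: "locally_integrable B f"
    and 0: "\<And>\<psi>. \<psi> \<in> test_functions B \<Longrightarrow> (LINT x:B|lebesgue. f x * \<psi> x) = 0"
    and sub: "cbox a b \<subseteq> B"
  shows "(LINT x:box a b|lebesgue. f x) = 0"
proof (cases "box a b = {}")
  case False
  obtain \<psi> where \<psi>: "\<And>n. \<psi> n \<in> test_functions B" "\<And>n x. 0 \<le> \<psi> n x" "\<And>n x. \<psi> n x \<le> (1::real)"
    "\<And>n x. \<psi> n x \<noteq> 0 \<longleftrightarrow> x \<in> box a b" "\<And>x. (\<lambda>n. \<psi> n x) \<longlonglongrightarrow> indicator (box a b) x"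
    using test_functions_tendsto_indicator_box[OF False sub] by metis
  have cb: "integrable lebesgue (\<lambda>x. indicator (cbox a b) x *\<^sub>R f x)"
    using f sub by (simp add: locally_integrable_def set_integrable_def)
  have box_sub: "box a b \<subseteq> cbox a b" by (rule box_subset_cbox)
  have meas: "\<psi> n \<in> borel_measurable lebesgue" for n
    using borel_measurable_test_functions[OF \<psi>(1)] by (simp add: measurable_completion)
  \<comment> \<open>Only the restriction of \<open>f\<close> to compact subsets of \<open>B\<close>
    is known to be integrable or measurable. Since \<open>\<psi> n\<close> and the indicator vanish
    off the box, \<open>f\<close> may be replaced by its cutoff to the closed box, which also serves
    as dominating function.\<close>
  have eq: "\<psi> n x * f x = \<psi> n x * (indicator (cbox a b) x *\<^sub>R f x)"
    and eq2: "indicator (box a b) x * f x = indicator (box a b) x * (indicator (cbox a b) x *\<^sub>R f x)" for n x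
    using \<psi>(4)[of n x] box_sub by (auto simp: indicator_def)
  have "(\<lambda>n. LINT x|lebesgue. \<psi> n x * f x) \<longlonglongrightarrow> (LINT x|lebesgue. indicator (box a b) x * f x)"
  proof (rule integral_dominated_convergence)
    show "integrable lebesgue (\<lambda>x. norm (indicator (cbox a b) x *\<^sub>R f x))"
      using cb by simp
    show "(\<lambda>x. \<psi> n x * f x) \<in> borel_measurable lebesgue" for n
      unfolding eq by (intro borel_measurable_times meas borel_measurable_integrable[OF cb])
    show "(\<lambda>x. indicator (box a b) x * f x) \<in> borel_measurable lebesgue"
      unfolding eq2 by (intro borel_measurable_times borel_measurable_integrable[OF cb] borel_measurable_indicator) simp
    show "AE x in lebesgue. (\<lambda>n. \<psi> n x * f x) \<longlonglongrightarrow> indicator (box a b) x * f x"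
      by (intro AE_I2 tendsto_intros \<psi>)
    show "AE x in lebesgue. norm (\<psi> n x * f x) \<le> norm (indicator (cbox a b) x *\<^sub>R f x)" for n
    proof (rule AE_I2)
      fix x show "norm (\<psi> n x * f x) \<le> norm (indicator (cbox a b) x *\<^sub>R f x)"
        unfolding eq using \<psi>(2,3)[of n x] by (simp add: abs_mult mult_left_le_one_le)
    qed
  qed
  moreover have "(LINT x|lebesgue. \<psi> n x * f x) = 0" for n
  proof -
    have "(LINT x|lebesgue. \<psi> n x * f x) = (LINT x:B|lebesgue. f x * \<psi> n x)"
      unfolding set_lebesgue_integral_def
      by (rule Bochner_Integration.integral_cong)
        (auto simp: indicator_def test_functions_eq_0[OF \<psi>(1)])
    then show ?thesis using 0 \<psi>(1) by simp
  qed
  ultimately show ?thesis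
    by (simp add: set_lebesgue_integral_def LIMSEQ_const_iff)
qed (simp add: set_lebesgue_integral_def)

text \<open>Boxes are stable under intersection and generate the Borel sets, so Dynkin's argument
  carries the vanishing of the integral from boxes to all Borel sets; a density is determined by its
  integrals over measurable sets.\<close>

lemma AE_eq_0_if_box_integrals_eq_0:
  fixes f :: "'a::euclidean_space \<Rightarrow> real"
  assumes f: "integrable lebesgue f"
    and 0: "\<And>a b. (LINT x:box a b|lebesgue. f x) = 0"
  shows "AE x in lebesgue. f x = 0"
proof (rule density_unique_real[OF f])
  show "integrable lebesgue (\<lambda>x. 0::real)" by simp
  have UN: "(\<Union>n::nat. box (- (real n *\<^sub>R One)) (real n *\<^sub>R One)) = (UNIV::'a set)"
    by (rule UN_box_eq_UNIV)
  have fA: "set_integrable lebesgue A f" if "A \<in> sets lebesgue" for A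
    unfolding set_integrable_def by (rule integrable_mult_indicator[OF that f])
  \<comment> \<open>Complements in the Dynkin argument need the integral over the whole space,
    obtained here by exhausting it with growing boxes.\<close>
  have "(\<lambda>n. LINT x:box (- (real n *\<^sub>R One)) (real n *\<^sub>R One)|lebesgue. f x) \<longlonglongrightarrow>
      (LINT x:(\<Union>n::nat. box (- (real n *\<^sub>R One)) (real n *\<^sub>R One))|lebesgue. f x)"
    by (rule set_integral_cont_up)
      (auto simp: incseq_def subset_box fA)
  then have total: "(LINT x|lebesgue. f x) = 0"
    unfolding UN 0 by (simp add: set_lebesgue_integral_def LIMSEQ_const_iff)
  have sigma_box: "sigma_sets UNIV (range (\<lambda>(a, b). box a b :: 'a set)) = sets borel"
    by (simp add: borel_eq_box)
  have borel: "(LINT x:A|lebesgue. f x) = 0" if "A \<in> sets borel" for A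
  proof -
    have "Int_stable (range (\<lambda>(a, b). box a b :: 'a set))"
      by (auto simp: Int_stable_def box_Int_box)
    moreover have "range (\<lambda>(a, b). box a b :: 'a set) \<subseteq> Pow UNIV"
      by auto
    moreover have "A \<in> sigma_sets UNIV (range (\<lambda>(a, b). box a b))"
      using that unfolding borel_eq_box by simp
    ultimately show ?thesis
    proof (induction rule: sigma_sets_induct_disjoint)
      case (compl A)
      then have A: "A \<in> sets lebesgue"
        unfolding sigma_box by (simp add: sets_completionI_sets)
      have "(LINT x:UNIV - A|lebesgue. f x) = (LINT x|lebesgue. f x - indicator A x *\<^sub>R f x)"
        unfolding set_lebesgue_integral_def
        by (rule Bochner_Integration.integral_cong) (auto simp: indicator_def)
      also have "\<dots> = (LINT x|lebesgue. f x) - (LINT x:A|lebesgue. f x)"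
        using f fA[OF A] unfolding set_lebesgue_integral_def set_integrable_def
        by (rule Bochner_Integration.integral_diff)
      finally show ?case
        using total compl by simp
    next
      case (union A)
      then have A: "A i \<in> sets lebesgue" for i
        unfolding sigma_box by (auto intro!: sets_completionI_sets)
      have "(LINT x:(\<Union>i. A i)|lebesgue. f x) = (\<Sum>i. LINT x:A i|lebesgue. f x)"
        using A union by (intro lebesgue_integral_countable_add fA)
          (auto simp: disjoint_family_on_def)
      then show ?case using union by simp
    qed (use 0 in \<open>auto simp: set_lebesgue_integral_def\<close>)
  qed
  show "(LINT x:A|lebesgue. f x) = (LINT x:A|lebesgue. 0)" if A: "A \<in> sets lebesgue" for A
  proof -
    \<comment> \<open>A Lebesgue set differs from a Borel set by a null set, which does not affect
      the integral.\<close>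
    obtain S N N' where S: "A = S \<union> N" "N \<subseteq> N'" "N' \<in> null_sets lborel" "S \<in> sets lborel"
      by (rule sets_completionE[OF A])
    have "AE x in lborel. x \<notin> N'"
      using S(3) by (rule AE_not_in)
    then have "AE x in lebesgue. x \<notin> N'"
      by (rule AE_completion)
    then have ae: "AE x in lebesgue. x \<in> A \<longleftrightarrow> x \<in> S"
      by eventually_elim (use S in auto)
    have S': "S \<in> sets lebesgue" using S(4) by simp
    have "(LINT x:A|lebesgue. f x) = (LINT x:S|lebesgue. f x)"
      by (rule set_integral_cong_set)
        (use ae fA[OF A] fA[OF S'] in \<open>auto simp: set_borel_measurable_def set_integrable_def\<close>)
    then show ?thesis
      using borel S(4) by simp
  qed
qed

text \<open>The previous lemma needs a function integrable on the whole space. So \<open>f\<close>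
  is cut off to closed boxes inside \<open>B\<close>, countably many of which cover
  \<open>B\<close>. Integrating such a cutoff over a box means integrating \<open>f\<close> over an
  intersection of two boxes, up to the null set of faces.\<close>

lemma fundamental_lemma_calculus_of_variations:
  fixes f :: "'a::euclidean_space \<Rightarrow> real"
  assumes B: "open B" and f: "locally_integrable B f"
    and 0: "\<And>\<psi>. \<psi> \<in> test_functions B \<Longrightarrow> (LINT x:B|lebesgue. f x * \<psi> x) = 0"
  shows "AE x in lebesgue_on B. f x = 0"
proof -
  obtain \<D> where D: "countable \<D>" "\<D> \<subseteq> Pow B" "\<And>X. X \<in> \<D> \<Longrightarrow> \<exists>a b. X = cbox a b" "\<Union>\<D> = B"
    using open_countable_Union_open_cbox[OF B] by metis
  have "AE x in lebesgue. x \<in> X \<longrightarrow> f x = 0" if X: "X \<in> \<D>" for X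
  proof -
    obtain c d where cd: "X = cbox c d" "cbox c d \<subseteq> B"
      using D X by blast
    have "AE x in lebesgue. indicator (cbox c d) x *\<^sub>R f x = 0"
    proof (rule AE_eq_0_if_box_integrals_eq_0)
      show int: "integrable lebesgue (\<lambda>x. indicator (cbox c d) x *\<^sub>R f x)"
        using f cd by (simp add: locally_integrable_def set_integrable_def)
      fix a b :: 'a
      obtain a' b' where ab': "box a b \<inter> box c d = box a' b'"
        by (rule that[OF box_Int_box])
      have "box a' b' \<subseteq> cbox c d"
        using box_subset_cbox[of c d] by (auto simp: ab'[symmetric])
      \<comment> \<open>For an empty intersection \<open>cbox a' b'\<close> may still be nonempty
        and leave \<open>B\<close>; the integral over the empty open box is then 0 anyway.\<close>
      then have "box a' b' \<noteq> {} \<Longrightarrow> cbox a' b' \<subseteq> cbox c d"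
        using closure_minimal[of "box a' b'" "cbox c d"] by (simp add: closure_box closed_cbox)
      then have z: "(LINT x:box a' b'|lebesgue. f x) = 0"
        using integral_box_eq_0[OF B f 0, of a' b'] cd by (cases "box a' b' = {}") (auto simp: set_lebesgue_integral_def)
      have "AE x in lborel. x \<notin> cbox c d - box c d"
        using null_sets_cbox_Diff_box by (rule AE_not_in)
      then have ae: "AE x in lebesgue. x \<notin> cbox c d - box c d"
        by (rule AE_completion)
      have "(LINT x:box a b|lebesgue. indicator (cbox c d) x *\<^sub>R f x) = (LINT x:box a' b'|lebesgue. f x)"
        unfolding set_lebesgue_integral_def
      proof (rule integral_cong_AE)
        show "(\<lambda>x. indicator (box a b) x *\<^sub>R indicator (cbox c d) x *\<^sub>R f x) \<in> borel_measurable lebesgue"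
          by (intro borel_measurable_scaleR borel_measurable_integrable[OF int] borel_measurable_indicator) simp
        have "(\<lambda>x. indicator (box a' b') x *\<^sub>R f x) =
            (\<lambda>x. indicator (box a' b') x *\<^sub>R indicator (cbox c d) x *\<^sub>R f x)"
          unfolding ab'[symmetric] using box_subset_cbox[of c d] by (auto simp: indicator_def fun_eq_iff)
        then show "(\<lambda>x. indicator (box a' b') x *\<^sub>R f x) \<in> borel_measurable lebesgue"
          by (simp only:) (intro borel_measurable_scaleR borel_measurable_integrable[OF int] borel_measurable_indicator, simp)
        show "AE x in lebesgue. indicator (box a b) x *\<^sub>R indicator (cbox c d) x *\<^sub>R f x =
            indicator (box a' b') x *\<^sub>R f x"
          using ae by eventually_elim
            (use box_subset_cbox[of c d] in \<open>auto simp: indicator_def ab'[symmetric]\<close>)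
      qed
      with z show "(LINT x:box a b|lebesgue. indicator (cbox c d) x *\<^sub>R f x) = 0"
        by simp
    qed
    then show ?thesis
      by eventually_elim (auto simp: cd)
  qed
  then have "AE x in lebesgue. \<forall>X\<in>\<D>. x \<in> X \<longrightarrow> f x = 0"
    using AE_ball_countable[OF D(1), of "\<lambda>x X. x \<in> X \<longrightarrow> f x = 0"] by blast
  then have "AE x in lebesgue. x \<in> B \<longrightarrow> f x = 0"
    by eventually_elim (use D(4) in auto)
  then show ?thesis
    using B by (simp add: AE_restrict_space_iff)
qed

text \<open>This makes \<open>weak_grad\<close> usable: whichever representative was chosen, it
  agrees almost everywhere with any weak gradient that can be exhibited. Each component of the
  difference is orthogonal to all test functions.\<close>

lemma has_weak_gradient_unique:
  assumes B: "open B" and g: "has_weak_gradient B u g" and h: "has_weak_gradient B u h"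
  shows "AE x in lebesgue_on B. g x = h x"
proof -
  have lg: "locally_integrable B g" and lh: "locally_integrable B h"
    using g h by (auto simp: has_weak_gradient_def)
  have "AE x in lebesgue_on B. (g x - h x) \<bullet> i = 0" if i: "i \<in> Basis" for i
  proof (rule fundamental_lemma_calculus_of_variations[OF B])
    show "locally_integrable B (\<lambda>x. (g x - h x) \<bullet> i)"
      unfolding locally_integrable_def set_integrable_def
    proof (intro allI impI)
      fix K assume "compact K \<and> K \<subseteq> B"
      then have "integrable lebesgue (\<lambda>x. (indicator K x *\<^sub>R g x) \<bullet> i - (indicator K x *\<^sub>R h x) \<bullet> i)"
        using lg lh unfolding locally_integrable_def set_integrable_def
        by (intro Bochner_Integration.integrable_diff integrable_inner_left) auto
      then show "integrable lebesgue (\<lambda>x. indicator K x *\<^sub>R ((g x - h x) \<bullet> i))"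
        by (simp add: inner_diff_left right_diff_distrib)
    qed
    fix \<psi> assume \<psi>: "\<psi> \<in> test_functions B"
    have int: "integrable (lebesgue_on B) (\<lambda>x. (\<psi> x *\<^sub>R g x) \<bullet> i)" "integrable (lebesgue_on B) (\<lambda>x. (\<psi> x *\<^sub>R h x) \<bullet> i)"
      using integrable_test_scaleR[OF B lg \<psi>] integrable_test_scaleR[OF B lh \<psi>]
      by (auto simp del: inner_scaleR_left intro!: integrable_inner_left)
    have "(LINT x:B|lebesgue. (g x - h x) \<bullet> i * \<psi> x) =
        (LINT x|lebesgue_on B. (\<psi> x *\<^sub>R g x) \<bullet> i - (\<psi> x *\<^sub>R h x) \<bullet> i)"
      unfolding set_lebesgue_integral_lebesgue_on[OF B]
      by (rule Bochner_Integration.integral_cong) (auto simp: algebra_simps)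
    also have "\<dots> = (LINT x|lebesgue_on B. (\<psi> x *\<^sub>R g x) \<bullet> i) - (LINT x|lebesgue_on B. (\<psi> x *\<^sub>R h x) \<bullet> i)"
      by (rule Bochner_Integration.integral_diff[OF int])
    also have "\<dots> = (LINT x:B|lebesgue. g x \<bullet> i * \<psi> x) - (LINT x:B|lebesgue. h x \<bullet> i * \<psi> x)"
      unfolding set_lebesgue_integral_lebesgue_on[OF B] by (simp add: mult.commute)
    also have "\<dots> = 0"
      using g[unfolded has_weak_gradient_def] h[unfolded has_weak_gradient_def] \<psi> i by simp
    finally show "(LINT x:B|lebesgue. (g x - h x) \<bullet> i * \<psi> x) = 0" .
  qed
  then have "AE x in lebesgue_on B. \<forall>i\<in>Basis. (g x - h x) \<bullet> i = 0"
    by (simp add: AE_finite_all)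
  then show ?thesis
    by eventually_elim (simp add: euclidean_eq_iff[of "g _"] inner_diff_left)
qed

subsection \<open>Weak gradients of Lipschitz functions\<close>

lemma has_real_derivative_along_line:
  assumes "(F has_derivative F') (at (x + t *\<^sub>R v))"
  shows "((\<lambda>s. F (x + s *\<^sub>R v)) has_real_derivative F' v) (at t)"
proof -
  have "((\<lambda>s. x + s *\<^sub>R v) has_derivative (\<lambda>s. s *\<^sub>R v)) (at t)"
    by (auto intro!: derivative_eq_intros)
  then have "((\<lambda>s. F (x + s *\<^sub>R v)) has_derivative (\<lambda>s. F' (s *\<^sub>R v))) (at t)"
    using assms by (rule has_derivative_compose)
  moreover have "F' (s *\<^sub>R v) = F' v * s" for s
    using linear_scale[OF has_derivative_linear[OF assms], of s v] by simp
  ultimately show ?thesis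
    by (simp add: has_field_derivative_def)
qed

lemma difference_quotient_tendsto:
  assumes "(F has_derivative F') (at x)" "\<And>n. h n \<noteq> 0" "h \<longlonglongrightarrow> 0"
  shows "(\<lambda>n. (F (x + h n *\<^sub>R v) - F x) / h n) \<longlonglongrightarrow> F' v"
proof -
  have "((\<lambda>s. F (x + s *\<^sub>R v)) has_real_derivative F' v) (at 0)"
    using assms(1) by (intro has_real_derivative_along_line) simp
  then have "((\<lambda>s. (F (x + s *\<^sub>R v) - F x) / s) \<longlongrightarrow> F' v) (at 0)"
    by (simp add: DERIV_def)
  then show ?thesis
    by (rule filterlim_compose) (use assms in \<open>auto simp: filterlim_at\<close>)
qed

lemma integrable_lborel_imp_lebesgue:
  fixes f :: "'a::euclidean_space \<Rightarrow> 'b::euclidean_space"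
  shows "integrable lborel f \<Longrightarrow> integrable lebesgue f"
  using integrable_completion[of f lborel] borel_measurable_integrable[of lborel f] by blast

lemma integrable_lborel_continuous_compact_support:
  fixes k :: "'a::euclidean_space \<Rightarrow> real"
  assumes "continuous_on UNIV k" "compact K" "\<And>x. x \<notin> K \<Longrightarrow> k x = 0"
  shows "integrable lborel k"
proof -
  have "integrable lborel (\<lambda>x. indicator K x *\<^sub>R k x)"
    using assms by (intro borel_integrable_compact) (auto intro: continuous_on_subset)
  moreover have "(\<lambda>x. indicator K x *\<^sub>R k x) = k"
    using assms(3) by (auto simp: indicator_def fun_eq_iff)
  ultimately show ?thesis by simp
qed

lemma lborel_integral_translation:
  fixes k :: "'a::euclidean_space \<Rightarrow> real"
  assumes "k \<in> borel_measurable borel"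
  shows "(LINT x|lborel. k (c + x)) = (LINT x|lborel. k x)"
proof -
  have "(LINT x|lborel. k x) = (LINT x|distr lborel borel ((+) c). k x)"
    by (simp add: lborel_distr_plus)
  also have "\<dots> = (LINT x|lborel. k (c + x))"
    using assms by (intro integral_distr) auto
  finally show ?thesis by simp
qed

text \<open>The mean value theorem along the line bounds the quotients by the maximum of the partial
  derivative, uniformly in the point and the step: the domination needed when the step tends to
  0.\<close>

lemma test_functions_difference_quotient_bound:
  assumes \<psi>: "\<psi> \<in> test_functions B" and i: "i \<in> Basis"
  obtains M where "M > 0" "\<And>x h. h > 0 \<Longrightarrow> \<bar>(\<psi> (x + h *\<^sub>R i) - \<psi> x) / h\<bar> \<le> M"
proof -
  obtain M where M: "M > 0" "\<And>x. \<bar>frechet_derivative \<psi> (at x) i\<bar> \<le> M"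
    by (rule test_functions_bounded[OF test_functions_partial[OF \<psi> i]]) blast
  have "\<bar>(\<psi> (x + h *\<^sub>R i) - \<psi> x) / h\<bar> \<le> M" if "h > 0" for x h
  proof -
    have "((\<lambda>s. \<psi> (x + s *\<^sub>R i)) has_real_derivative
        frechet_derivative \<psi> (at (x + t *\<^sub>R i)) i) (at t)" for t
      using test_functions_differentiable[OF \<psi>]
      by (intro has_real_derivative_along_line) (simp add: frechet_derivative_works[symmetric])
    from MVT2[OF that this] obtain z where "\<psi> (x + h *\<^sub>R i) - \<psi> x =
        h * frechet_derivative \<psi> (at (x + z *\<^sub>R i)) i"
      by auto
    then show ?thesis
      using that M(2) by simp
  qed
  with M(1) show thesis
    using that by blast
qed

text \<open>Discrete integration by parts: translation invariance moves the shift by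
  \<open>h n\<close> from \<open>\<psi>\<close> to \<open>f\<close> and reverses its direction,
  hence the backward quotients of \<open>f\<close>. The limit is taken on the side of
  \<open>\<psi>\<close>, where smoothness gives domination, so continuity of \<open>f\<close>
  suffices.\<close>

lemma continuous_integration_by_parts_limit:
  fixes f :: "'a::euclidean_space \<Rightarrow> real"
  assumes f: "continuous_on UNIV f" and \<psi>: "\<psi> \<in> test_functions B" and i: "i \<in> Basis"
    and h: "\<And>n. 0 < h n" "\<And>n. h n \<le> 1" "h \<longlonglongrightarrow> 0"
  shows "(\<lambda>n. LINT x|lborel. (f (x - h n *\<^sub>R i) - f x) / h n * \<psi> x)
    \<longlonglongrightarrow> (LINT x|lborel. f x * frechet_derivative \<psi> (at x) i)"
proof -
  obtain K where K: "compact K" "K \<subseteq> B" "\<And>x. x \<notin> K \<Longrightarrow> \<psi> x = 0"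
    by (rule test_functions_support[OF \<psi>]) blast
  obtain M where M: "M > 0" "\<And>x h. h > 0 \<Longrightarrow> \<bar>(\<psi> (x + h *\<^sub>R i) - \<psi> x) / h\<bar> \<le> M"
    by (rule test_functions_difference_quotient_bound[OF \<psi> i]) blast
  \<comment> \<open>As the steps are at most 1, the unit neighbourhood of \<open>K\<close> contains
    the supports of all shifted copies of \<open>\<psi>\<close>.\<close>
  define K' where "K' = {x + y |x y. x \<in> K \<and> y \<in> cball 0 (1::real) }"
  have K': "compact K'"
    unfolding K'_def by (rule compact_sums[OF K(1) compact_cball])
  have K'1: "\<psi> x = 0" if "x \<notin> K'" for x
    using that K(3)[of x] unfolding K'_def by (force intro: exI[of _ 0])
  have K'2: "\<psi> (x + h n *\<^sub>R i) = 0" if "x \<notin> K'" for x n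
  proof (rule K(3), rule notI)
    assume "x + h n *\<^sub>R i \<in> K"
    moreover have "- (h n *\<^sub>R i) \<in> cball 0 1"
      using h(1,2)[of n] i by simp
    moreover have "x = (x + h n *\<^sub>R i) + - (h n *\<^sub>R i)"
      by simp
    ultimately have "x \<in> K'"
      unfolding K'_def by blast
    with that show False ..
  qed
  have c\<psi>: "continuous_on UNIV \<psi>"
    by (rule test_functions_continuous[OF \<psi>])
  have csh: "continuous_on UNIV (\<lambda>x. \<psi> (x + c))" for c
    by (rule continuous_on_compose2[OF c\<psi>]) (auto intro!: continuous_intros)
  have cfsh: "continuous_on UNIV (\<lambda>x. f (x - c))" for c
    by (rule continuous_on_compose2[OF f]) (auto intro!: continuous_intros)
  have I: "integrable lborel (\<lambda>x. f x * \<psi> x)" "integrable lborel (\<lambda>x. f (x - c) * \<psi> x)"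
    "integrable lborel (\<lambda>x. f x * \<psi> (x + h n *\<^sub>R i))" for c n
    by (rule integrable_lborel_continuous_compact_support[OF _ K'];
        auto intro!: continuous_intros f c\<psi> csh cfsh simp: K'1 K'2)+
  have [measurable]: "f \<in> borel_measurable borel" "\<psi> \<in> borel_measurable borel"
    "(\<lambda>x. frechet_derivative \<psi> (at x) i) \<in> borel_measurable borel"
    using f c\<psi> borel_measurable_test_functions[OF test_functions_partial[OF \<psi> i]]
    by (auto intro: borel_measurable_continuous_onI)
  have "(\<lambda>n. LINT x|lborel. f x * ((\<psi> (x + h n *\<^sub>R i) - \<psi> x) / h n))
    \<longlonglongrightarrow> (LINT x|lborel. f x * frechet_derivative \<psi> (at x) i)"
  proof (rule integral_dominated_convergence)
    show "integrable lborel (\<lambda>x. indicator K' x *\<^sub>R (M * \<bar>f x\<bar>))"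
      by (rule borel_integrable_compact[OF K']) (auto intro!: continuous_intros continuous_on_subset[OF f])
    show "AE x in lborel. (\<lambda>n. f x * ((\<psi> (x + h n *\<^sub>R i) - \<psi> x) / h n))
        \<longlonglongrightarrow> f x * frechet_derivative \<psi> (at x) i"
    proof (intro AE_I2 tendsto_intros difference_quotient_tendsto h(3))
      fix x show "(\<psi> has_derivative frechet_derivative \<psi> (at x)) (at x)"
        using test_functions_differentiable[OF \<psi>] by (simp add: frechet_derivative_works[symmetric])
      fix n show "h n \<noteq> 0" using h(1)[of n] by simp
    qed
    show "AE x in lborel. norm (f x * ((\<psi> (x + h n *\<^sub>R i) - \<psi> x) / h n))
        \<le> indicator K' x *\<^sub>R (M * \<bar>f x\<bar>)" for n
    proof (rule AE_I2)
      fix x show "norm (f x * ((\<psi> (x + h n *\<^sub>R i) - \<psi> x) / h n)) \<le> indicator K' x *\<^sub>R (M * \<bar>f x\<bar>)"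
      proof (cases "x \<in> K'")
        case True
        then show ?thesis
          using mult_right_mono[OF M(2)[OF h(1)[of n], of x], of "\<bar>f x\<bar>"]
          by (simp add: abs_mult mult.commute)
      qed (simp add: K'1 K'2)
    qed
  qed measurable
  moreover have "(LINT x|lborel. f x * ((\<psi> (x + h n *\<^sub>R i) - \<psi> x) / h n)) =
      (LINT x|lborel. (f (x - h n *\<^sub>R i) - f x) / h n * \<psi> x)" for n
  proof -
    have "(LINT x|lborel. f x * ((\<psi> (x + h n *\<^sub>R i) - \<psi> x) / h n)) =
        (LINT x|lborel. (f x * \<psi> (x + h n *\<^sub>R i) - f x * \<psi> x) / h n)"
      by (simp add: algebra_simps diff_divide_distrib)
    also have "\<dots> = ((LINT x|lborel. f x * \<psi> (x + h n *\<^sub>R i)) - (LINT x|lborel. f x * \<psi> x)) / h n"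
      using I by simp
    also have "(LINT x|lborel. f x * \<psi> (x + h n *\<^sub>R i)) = (LINT x|lborel. f (x - h n *\<^sub>R i) * \<psi> x)"
      using lborel_integral_translation[of "\<lambda>x. f (x - h n *\<^sub>R i) * \<psi> x" "h n *\<^sub>R i"]
      by (simp add: add.commute)
    also have "(\<dots> - (LINT x|lborel. f x * \<psi> x)) / h n =
        (LINT x|lborel. (f (x - h n *\<^sub>R i) * \<psi> x - f x * \<psi> x) / h n)"
      using I by simp
    finally show ?thesis
      by (simp add: algebra_simps diff_divide_distrib)
  qed
  ultimately show ?thesis by (simp only:)
qed

lemma set_integral_test_functions_UNIV:
  assumes "\<psi> \<in> test_functions B"
  shows "(LINT x:B|lebesgue. F x * \<psi> x) = (LINT x|lebesgue. F x * \<psi> x)"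
  unfolding set_lebesgue_integral_def
  by (rule Bochner_Integration.integral_cong)
    (auto simp: indicator_def test_functions_eq_0[OF assms])

text \<open>Both sides of the discrete integration by parts converge. Now the quotients of
  \<open>f\<close> are dominated as well, by the Lipschitz constant, and they tend to minus the
  component of \<open>g\<close> almost everywhere; equality of the two limits is the weak gradient
  identity.\<close>

lemma lipschitz_has_weak_gradient:
  fixes f :: "'a::euclidean_space \<Rightarrow> real"
  assumes B: "open B" and lip: "L-lipschitz_on UNIV f"
    and g: "AE x in lebesgue_on B. GDERIV f x :> g x"
  shows "has_weak_gradient B f g"
proof -
  define h where "h n = inverse (real (Suc n))" for n
  have h: "\<And>n. 0 < h n" "\<And>n. h n \<le> 1" "h \<longlonglongrightarrow> 0"
    using LIMSEQ_inverse_real_of_nat by (auto simp: h_def[abs_def] inverse_le_1_iff)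
  have cf: "continuous_on UNIV f"
    by (rule lipschitz_on_continuous_on[OF lip])
  then have mf: "f \<in> borel_measurable borel"
    by (rule borel_measurable_continuous_onI)
  have Lbound: "\<bar>f (x + c *\<^sub>R i) - f x\<bar> \<le> L * \<bar>c\<bar>" if "i \<in> Basis" for x c i
    using lipschitz_onD[OF lip, of "x + c *\<^sub>R i" x] that by (simp add: dist_norm)
  have L: "L \<ge> 0"
    using lip by (simp add: lipschitz_on_def)
  have g': "AE x in lebesgue. x \<in> B \<longrightarrow> GDERIV f x :> g x"
    using g B by (simp add: AE_restrict_space_iff)
  \<comment> \<open>The forward quotients are for the size and measurability of \<open>g\<close>,
    the backward ones for the integration by parts.\<close>
  have lim: "AE x in lebesgue. x \<in> B \<longrightarrow> (\<forall>i\<in>Basis.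
      (\<lambda>n. (f (x + h n *\<^sub>R i) - f x) / h n) \<longlonglongrightarrow> g x \<bullet> i \<and>
      (\<lambda>n. (f (x - h n *\<^sub>R i) - f x) / h n) \<longlonglongrightarrow> - (g x \<bullet> i))"
    using g'
  proof eventually_elim
    case (elim x)
    show ?case
    proof (intro impI ballI conjI)
      fix i :: 'a assume "x \<in> B" and i: "i \<in> Basis"
      then have d: "(f has_derivative (\<lambda>h. h \<bullet> g x)) (at x)"
        using elim by (simp add: gderiv_def)
      have nz: "h n \<noteq> 0" for n
        using h(1)[of n] by simp
      show "(\<lambda>n. (f (x + h n *\<^sub>R i) - f x) / h n) \<longlonglongrightarrow> g x \<bullet> i"
        using difference_quotient_tendsto[OF d nz h(3), of i] by (simp add: inner_commute)
      show "(\<lambda>n. (f (x - h n *\<^sub>R i) - f x) / h n) \<longlonglongrightarrow> - (g x \<bullet> i)"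
        using difference_quotient_tendsto[OF d nz h(3), of "- i"] by (simp add: inner_commute)
    qed
  qed
  \<comment> \<open>A bound by components costs the factor \<open>DIM('a)\<close>, harmless because
    only local integrability of \<open>g\<close> is wanted.\<close>
  have g_le: "AE x in lebesgue. x \<in> B \<longrightarrow> norm (g x) \<le> real DIM('a) * L"
    using lim
  proof eventually_elim
    case (elim x)
    show ?case
    proof
      assume x: "x \<in> B"
      have "\<bar>g x \<bullet> i\<bar> \<le> L" if i: "i \<in> Basis" for i
      proof (rule Lim_bounded)
        show "(\<lambda>n. \<bar>(f (x + h n *\<^sub>R i) - f x) / h n\<bar>) \<longlonglongrightarrow> \<bar>g x \<bullet> i\<bar>"
          using elim x i by (intro tendsto_rabs) auto
        show "\<forall>n\<ge>0. \<bar>(f (x + h n *\<^sub>R i) - f x) / h n\<bar> \<le> L"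
        proof (intro allI impI)
          fix n show "\<bar>(f (x + h n *\<^sub>R i) - f x) / h n\<bar> \<le> L"
            using Lbound[OF i, of x "h n"] h(1)[of n] by (simp add: divide_le_eq)
        qed
      qed
      then have "(\<Sum>i\<in>Basis. \<bar>g x \<bullet> i\<bar>) \<le> real DIM('a) * L"
        by (rule sum_bounded_above)
      with norm_le_l1[of "g x"] show "norm (g x) \<le> real DIM('a) * L"
        by linarith
    qed
  qed
  \<comment> \<open>\<open>g\<close> is given only as a pointwise derivative. Its components agree
    almost everywhere with limits of Borel functions, and completeness of Lebesgue measure then
    gives measurability. Where the quotients diverge \<open>lim\<close> is arbitrary, but within
    \<open>B\<close> this is a null set.\<close>
  have mg: "(\<lambda>x. indicator B x *\<^sub>R g x) \<in> borel_measurable lebesgue"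
  proof (subst borel_measurable_euclidean_space, intro ballI)
    fix i :: 'a assume i: "i \<in> Basis"
    have "(\<lambda>x. (f (x + h n *\<^sub>R i) - f x) / h n) \<in> borel_measurable lborel" for n
      using mf by measurable
    then have "(\<lambda>x. indicator B x * lim (\<lambda>n. (f (x + h n *\<^sub>R i) - f x) / h n)) \<in> borel_measurable lborel"
      using B by (intro borel_measurable_times borel_measurable_indicator borel_measurable_lim_metric) auto
    then have "(\<lambda>x. indicator B x * lim (\<lambda>n. (f (x + h n *\<^sub>R i) - f x) / h n)) \<in> borel_measurable lebesgue"
      by (rule measurable_completion)
    then show "(\<lambda>x. (indicator B x *\<^sub>R g x) \<bullet> i) \<in> borel_measurable lebesgue"
    proof (rule borel_measurable_AE)
      show "AE x in lebesgue. indicator B x * lim (\<lambda>n. (f (x + h n *\<^sub>R i) - f x) / h n) =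
          (indicator B x *\<^sub>R g x) \<bullet> i"
        using lim by eventually_elim (use i in \<open>auto simp: indicator_def intro!: limI\<close>)
    qed
  qed
  have "locally_integrable B f"
    unfolding locally_integrable_def set_integrable_def
  proof (intro allI impI)
    fix K assume "compact K \<and> K \<subseteq> B"
    then have "integrable lborel (\<lambda>x. indicator K x *\<^sub>R f x)"
      by (intro borel_integrable_compact continuous_on_subset[OF cf]) auto
    then show "integrable lebesgue (\<lambda>x. indicator K x *\<^sub>R f x)"
      by (rule integrable_lborel_imp_lebesgue)
  qed
  moreover have "locally_integrable B g"
    unfolding locally_integrable_def set_integrable_def
  proof (intro allI impI)
    fix K assume K: "compact K \<and> K \<subseteq> B"
    have "integrable lborel (\<lambda>x. indicator K x *\<^sub>R (real DIM('a) * L))"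
      using K by (intro borel_integrable_compact) auto
    then have "integrable lebesgue (\<lambda>x. indicator K x *\<^sub>R (real DIM('a) * L))"
      by (rule integrable_lborel_imp_lebesgue)
    then show "integrable lebesgue (\<lambda>x. indicator K x *\<^sub>R g x)"
    proof (rule Bochner_Integration.integrable_bound)
      have "(\<lambda>x. indicator K x *\<^sub>R g x) = (\<lambda>x. indicator K x *\<^sub>R (indicator B x *\<^sub>R g x))"
        using K by (auto simp: indicator_def fun_eq_iff)
      also have "\<dots> \<in> borel_measurable lebesgue"
        using K by (intro borel_measurable_scaleR mg borel_measurable_indicator)
          (simp add: compact_imp_closed borel_closed)
      finally show "(\<lambda>x. indicator K x *\<^sub>R g x) \<in> borel_measurable lebesgue" .
      show "AE x in lebesgue. norm (indicator K x *\<^sub>R g x) \<le> norm (indicator K x *\<^sub>R (real DIM('a) * L))"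
        using g_le by eventually_elim (use K L in \<open>auto simp: indicator_def\<close>)
    qed
  qed
  moreover have "(LINT x:B|lebesgue. f x * frechet_derivative \<psi> (at x) i) =
      - (LINT x:B|lebesgue. (g x \<bullet> i) * \<psi> x)"
    if \<psi>: "\<psi> \<in> test_functions B" and i: "i \<in> Basis" for \<psi> i
  proof -
    have [measurable]: "f \<in> borel_measurable borel" "\<psi> \<in> borel_measurable borel"
      "(\<lambda>x. frechet_derivative \<psi> (at x) i) \<in> borel_measurable borel"
      using mf \<psi> i by (auto intro: borel_measurable_test_functions test_functions_partial)
    obtain K where K: "compact K" "K \<subseteq> B" "\<And>x. x \<notin> K \<Longrightarrow> \<psi> x = 0"
      by (rule test_functions_support[OF \<psi>]) blast
    have "integrable lborel (\<lambda>x. L * \<bar>\<psi> x\<bar>)"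
      using K(3) by (intro integrable_lborel_continuous_compact_support[OF _ K(1)])
        (auto intro!: continuous_intros test_functions_continuous[OF \<psi>])
    then have int: "integrable lebesgue (\<lambda>x. L * \<bar>\<psi> x\<bar>)"
      by (rule integrable_lborel_imp_lebesgue)
    have "(\<lambda>n. LINT x|lebesgue. (f (x - h n *\<^sub>R i) - f x) / h n * \<psi> x)
        \<longlonglongrightarrow> (LINT x|lebesgue. - (g x \<bullet> i) * \<psi> x)"
    proof (rule integral_dominated_convergence[OF _ _ int])
      have "(\<lambda>x. - (g x \<bullet> i) * \<psi> x) = (\<lambda>x. - ((indicator B x *\<^sub>R g x) \<bullet> i) * \<psi> x)"
        by (auto simp: indicator_def fun_eq_iff test_functions_eq_0[OF \<psi>])
      also have "\<dots> \<in> borel_measurable lebesgue"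
        by (intro borel_measurable_times borel_measurable_uminus borel_measurable_inner mg
            borel_measurable_const measurable_completion) simp
      finally show "(\<lambda>x. - (g x \<bullet> i) * \<psi> x) \<in> borel_measurable lebesgue" .
      show "(\<lambda>x. (f (x - h n *\<^sub>R i) - f x) / h n * \<psi> x) \<in> borel_measurable lebesgue" for n
        by (rule measurable_completion) measurable
      show "AE x in lebesgue. (\<lambda>n. (f (x - h n *\<^sub>R i) - f x) / h n * \<psi> x) \<longlonglongrightarrow> - (g x \<bullet> i) * \<psi> x"
        using lim
      proof eventually_elim
        case (elim x)
        show ?case
        proof (cases "x \<in> B")
          case True
          with elim i show ?thesis by (intro tendsto_mult_right) auto
        qed (simp add: test_functions_eq_0[OF \<psi>])
      qed
      show "AE x in lebesgue. norm ((f (x - h n *\<^sub>R i) - f x) / h n * \<psi> x) \<le> L * \<bar>\<psi> x\<bar>" for n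
      proof (rule AE_I2)
        fix x
        have "\<bar>(f (x - h n *\<^sub>R i) - f x) / h n\<bar> \<le> L"
          using Lbound[OF i, of x "- h n"] h(1)[of n] by (simp add: divide_le_eq)
        then show "norm ((f (x - h n *\<^sub>R i) - f x) / h n * \<psi> x) \<le> L * \<bar>\<psi> x\<bar>"
          by (simp only: real_norm_def abs_mult mult_right_mono abs_ge_zero)
      qed
    qed
    \<comment> \<open>The limit of the integrals was computed for \<open>lborel\<close>, where
      translation invariance was used; for Borel functions the two integrals coincide.\<close>
    moreover have "(LINT x|lebesgue. (f (x - h n *\<^sub>R i) - f x) / h n * \<psi> x) =
        (LINT x|lborel. (f (x - h n *\<^sub>R i) - f x) / h n * \<psi> x)" for n
      by (rule integral_completion) measurable
    moreover have "(LINT x|lebesgue. f x * frechet_derivative \<psi> (at x) i) =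
        (LINT x|lborel. f x * frechet_derivative \<psi> (at x) i)"
      by (rule integral_completion) measurable
    ultimately have "(LINT x|lebesgue. f x * frechet_derivative \<psi> (at x) i) =
        (LINT x|lebesgue. - (g x \<bullet> i) * \<psi> x)"
      by (simp only:) (rule LIMSEQ_unique[OF continuous_integration_by_parts_limit[OF cf \<psi> i h]])
    then show ?thesis
      unfolding set_integral_test_functions_UNIV[OF \<psi>]
        set_integral_test_functions_UNIV[OF test_functions_partial[OF \<psi> i]]
      by simp
  qed
  ultimately show ?thesis
    by (simp add: has_weak_gradient_def)
qed

subsection \<open>The product rule\<close>

definition test_grad :: "('a::euclidean_space \<Rightarrow> real) \<Rightarrow> 'a \<Rightarrow> 'a" where
  "test_grad \<psi> x = (\<Sum>i\<in>Basis. frechet_derivative \<psi> (at x) i *\<^sub>R i)"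

lemma test_grad_inner: "i \<in> Basis \<Longrightarrow> test_grad \<psi> x \<bullet> i = frechet_derivative \<psi> (at x) i"
  unfolding test_grad_def by simp

lemma set_integrable_imp_locally_integrable:
  assumes "set_integrable lebesgue B f"
  shows "locally_integrable B f"
  unfolding locally_integrable_def
proof (intro allI impI)
  fix K assume "compact K \<and> K \<subseteq> B"
  then show "set_integrable lebesgue K f"
    by (intro set_integrable_subset[OF assms]) (auto simp: compact_imp_closed borel_closed)
qed

text \<open>Taken as the first factor in the product rule below, the constant 1 yields the weak
  gradient of a test function itself.\<close>

lemma has_weak_gradient_one: "open B \<Longrightarrow> has_weak_gradient B (\<lambda>x. 1) (\<lambda>x. 0)"
  by (rule lipschitz_has_weak_gradient[where L=0])
    (auto simp: lipschitz_on_def gderiv_def)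

lemma integrable_mult_test:
  fixes f :: "'a::euclidean_space \<Rightarrow> real"
  assumes "open B" "locally_integrable B f" "\<psi> \<in> test_functions B"
  shows "integrable (lebesgue_on B) (\<lambda>x. f x * \<psi> x)"
  using integrable_test_scaleR[OF assms] by (simp add: mult.commute)

lemma integrable_inner_mult_test:
  fixes f :: "'a::euclidean_space \<Rightarrow> 'a"
  assumes "open B" "locally_integrable B f" "\<psi> \<in> test_functions B"
  shows "integrable (lebesgue_on B) (\<lambda>x. (f x \<bullet> i) * \<psi> x)"
  using integrable_inner_left[OF integrable_test_scaleR[OF assms], of i] by (simp add: mult.commute)

lemma has_weak_gradient_integral:
  assumes "open B" "has_weak_gradient B f p" "\<eta> \<in> test_functions B" "i \<in> Basis"
  shows "(LINT x|lebesgue_on B. f x * frechet_derivative \<eta> (at x) i) =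
      - (LINT x|lebesgue_on B. (p x \<bullet> i) * \<eta> x)"
  using assms by (simp add: has_weak_gradient_def set_lebesgue_integral_lebesgue_on)

text \<open>The Leibniz rule for \<open>\<psi> * \<eta>\<close> splits the tested integral of
  \<open>f\<close>. The part that differentiates \<open>\<psi>\<close> changes sides and becomes the
  first summand of the gradient.\<close>

lemma has_weak_gradient_mult_test:
  fixes f :: "'a::euclidean_space \<Rightarrow> real"
  assumes B: "open B" and f: "has_weak_gradient B f p" and \<psi>: "\<psi> \<in> test_functions B"
  shows "has_weak_gradient B (\<lambda>x. f x * \<psi> x) (\<lambda>x. f x *\<^sub>R test_grad \<psi> x + \<psi> x *\<^sub>R p x)"
proof -
  have lf: "locally_integrable B f" and lp: "locally_integrable B p"
    using f by (auto simp: has_weak_gradient_def)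
  have "integrable (lebesgue_on B) (\<lambda>x. (f x * frechet_derivative \<psi> (at x) i) *\<^sub>R i)" if "i \<in> Basis" for i
    using integrable_mult_test[OF B lf test_functions_partial[OF \<psi> that]] by simp
  then have "integrable (lebesgue_on B) (\<lambda>x. f x *\<^sub>R test_grad \<psi> x)"
    unfolding test_grad_def scaleR_sum_right scaleR_scaleR by (rule Bochner_Integration.integrable_sum)
  then have int: "integrable (lebesgue_on B) (\<lambda>x. f x *\<^sub>R test_grad \<psi> x + \<psi> x *\<^sub>R p x)"
    using integrable_test_scaleR[OF B lp \<psi>] by (rule Bochner_Integration.integrable_add)
  have "(LINT x:B|lebesgue. f x * \<psi> x * frechet_derivative \<eta> (at x) i) =
      - (LINT x:B|lebesgue. (f x *\<^sub>R test_grad \<psi> x + \<psi> x *\<^sub>R p x) \<bullet> i * \<eta> x)"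
    if \<eta>: "\<eta> \<in> test_functions B" and i: "i \<in> Basis" for \<eta> i
  proof -
    note d = test_functions_partial[OF \<eta> i] test_functions_partial[OF \<psi> i]
    note int = integrable_mult_test[OF B lf test_functions_mult[OF d(1) test_functions_smooth[OF \<psi>]]]
      integrable_mult_test[OF B lf test_functions_mult[OF d(2) test_functions_smooth[OF \<eta>]]]
      integrable_inner_mult_test[OF B lp test_functions_mult[OF \<eta> test_functions_smooth[OF \<psi>]], of i]
    have dd: "frechet_derivative (\<lambda>x. \<psi> x * \<eta> x) (at x) i =
        \<psi> x * frechet_derivative \<eta> (at x) i + \<eta> x * frechet_derivative \<psi> (at x) i" for x
    proof -
      have "((\<lambda>x. \<psi> x * \<eta> x) has_derivative
          (\<lambda>h. \<psi> x * frechet_derivative \<eta> (at x) h + frechet_derivative \<psi> (at x) h * \<eta> x)) (at x)"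
        using test_functions_differentiable[OF \<psi>] test_functions_differentiable[OF \<eta>]
        by (intro has_derivative_mult) (simp_all add: frechet_derivative_works[symmetric])
      from frechet_derivative_at[OF this, symmetric] show ?thesis
        by simp
    qed
    have "(LINT x|lebesgue_on B. f x * (\<psi> x * frechet_derivative \<eta> (at x) i)) +
        (LINT x|lebesgue_on B. f x * (\<eta> x * frechet_derivative \<psi> (at x) i)) =
        (LINT x|lebesgue_on B. f x * frechet_derivative (\<lambda>x. \<psi> x * \<eta> x) (at x) i)"
      unfolding dd distrib_left by (rule Bochner_Integration.integral_add[OF int(1,2), symmetric])
    also have "\<dots> = - (LINT x|lebesgue_on B. (p x \<bullet> i) * (\<psi> x * \<eta> x))"
      by (rule has_weak_gradient_integral[OF B f test_functions_mult[OF \<eta> test_functions_smooth[OF \<psi>]] i])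
    finally have "(LINT x|lebesgue_on B. f x * (\<psi> x * frechet_derivative \<eta> (at x) i)) =
        - ((LINT x|lebesgue_on B. f x * (\<eta> x * frechet_derivative \<psi> (at x) i)) +
          (LINT x|lebesgue_on B. (p x \<bullet> i) * (\<psi> x * \<eta> x)))"
      by linarith
    also have "\<dots> = - (LINT x|lebesgue_on B. f x * (\<eta> x * frechet_derivative \<psi> (at x) i) +
          (p x \<bullet> i) * (\<psi> x * \<eta> x))"
      using int by simp
    finally show ?thesis
      using i by (simp add: set_lebesgue_integral_lebesgue_on[OF B] inner_add_left test_grad_inner
          algebra_simps)
  qed
  moreover have "locally_integrable B (\<lambda>x. f x * \<psi> x)"
    using integrable_mult_test[OF B lf \<psi>]
    by (intro set_integrable_imp_locally_integrable) (simp add: set_integrable_lebesgue_on[OF B])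
  moreover have "locally_integrable B (\<lambda>x. f x *\<^sub>R test_grad \<psi> x + \<psi> x *\<^sub>R p x)"
    using int by (intro set_integrable_imp_locally_integrable) (simp add: set_integrable_lebesgue_on[OF B])
  ultimately show ?thesis
    by (simp add: has_weak_gradient_def)
qed

lemma has_weak_gradient_test:
  "open B \<Longrightarrow> \<psi> \<in> test_functions B \<Longrightarrow> has_weak_gradient B \<psi> (test_grad \<psi>)"
  using has_weak_gradient_mult_test[OF _ has_weak_gradient_one] by fastforce

lemma locally_integrable_diff:
  "locally_integrable B f \<Longrightarrow> locally_integrable B g \<Longrightarrow> locally_integrable B (\<lambda>x. f x - g x)"
  unfolding locally_integrable_def by (auto intro!: set_integral_diff)

lemma has_weak_gradient_diff:
  assumes B: "open B" and u: "has_weak_gradient B u g" and v: "has_weak_gradient B v h"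
  shows "has_weak_gradient B (\<lambda>x. u x - v x) (\<lambda>x. g x - h x)"
proof -
  have l: "locally_integrable B u" "locally_integrable B g" "locally_integrable B v" "locally_integrable B h"
    using u v by (auto simp: has_weak_gradient_def)
  have "(LINT x|lebesgue_on B. (u x - v x) * frechet_derivative \<eta> (at x) i) =
      - (LINT x|lebesgue_on B. ((g x - h x) \<bullet> i) * \<eta> x)"
    if \<eta>: "\<eta> \<in> test_functions B" and i: "i \<in> Basis" for \<eta> i
    using integrable_mult_test[OF B l(1) test_functions_partial[OF \<eta> i]]
      integrable_mult_test[OF B l(3) test_functions_partial[OF \<eta> i]]
      integrable_inner_mult_test[OF B l(2) \<eta>, of i] integrable_inner_mult_test[OF B l(4) \<eta>, of i]
      has_weak_gradient_integral[OF B u \<eta> i] has_weak_gradient_integral[OF B v \<eta> i]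
    by (simp add: inner_diff_left left_diff_distrib)
  with l show ?thesis
    by (simp add: has_weak_gradient_def set_lebesgue_integral_lebesgue_on[OF B] locally_integrable_diff)
qed

lemma has_weak_gradient_weak_grad:
  "has_weak_gradient B u g \<Longrightarrow> has_weak_gradient B u (weak_grad B u)"
  using someI[of "has_weak_gradient B u" g] by (simp add: weak_grad_def)

lemma weak_grad_eq:
  "open B \<Longrightarrow> has_weak_gradient B u g \<Longrightarrow> AE x in lebesgue_on B. weak_grad B u x = g x"
  using has_weak_gradient_unique has_weak_gradient_weak_grad by blast

text \<open>Finite measure makes the constant 1 integrable, and t is at most 1 + t^2. It turns the
  square integrability in \<open>H1\<close> into the integrability needed for the tested
  integrals.\<close>

lemma integrable_norm_if_integrable_square:
  fixes f :: "'a \<Rightarrow> 'b::{banach, second_countable_topology}"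
  assumes "finite_measure M" and f[measurable]: "f \<in> borel_measurable M"
    and "integrable M (\<lambda>x. (norm (f x))\<^sup>2)"
  shows "integrable M f"
proof (rule Bochner_Integration.integrable_bound)
  show "integrable M (\<lambda>x. 1 + (norm (f x))\<^sup>2)"
    using assms by (intro Bochner_Integration.integrable_add finite_measure.integrable_const)
  have "t \<le> 1 + t\<^sup>2" for t :: real
    using zero_le_power2[of "t - 1/2"] by (simp add: power2_eq_square algebra_simps)
  then show "AE x in M. norm (f x) \<le> norm (1 + (norm (f x))\<^sup>2)"
    by (intro AE_I2) simp
qed measurable

text \<open>Young's inequality \<open>a \<le> t + a\<^sup>2 / t\<close> replaces Cauchy--Schwarz here.\<close>

lemma integral_norm_le_Young:
  fixes v :: "'a \<Rightarrow> real" and w :: "'a \<Rightarrow> 'b::{banach, second_countable_topology}"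
  assumes M: "finite_measure M" and t: "t > 0"
    and v: "integrable M v" "integrable M (\<lambda>x. (v x)\<^sup>2)"
    and w: "integrable M w" "integrable M (\<lambda>x. (norm (w x))\<^sup>2)"
  shows "(LINT x|M. \<bar>v x\<bar> + norm (w x)) \<le>
    2 * t * measure M (space M) + (LINT x|M. (v x)\<^sup>2 + (norm (w x))\<^sup>2) / t"
proof -
  interpret finite_measure M by fact
  have young: "a \<le> t + a\<^sup>2 / t" for a :: real
  proof -
    have "a * t \<le> t\<^sup>2 + a\<^sup>2"
      using zero_le_power2[of "a - t"] zero_le_power2[of "a + t"] by (simp add: power2_eq_square algebra_simps)
    then show ?thesis
      using t by (simp add: field_simps power2_eq_square)
  qed
  have "(LINT x|M. \<bar>v x\<bar> + norm (w x)) \<le>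
      (LINT x|M. 2 * t + ((v x)\<^sup>2 + (norm (w x))\<^sup>2) / t)"
  proof (rule integral_mono)
    show "integrable M (\<lambda>x. \<bar>v x\<bar> + norm (w x))"
      using v w by auto
    show "integrable M (\<lambda>x. 2 * t + ((v x)\<^sup>2 + (norm (w x))\<^sup>2) / t)"
      using v w by auto
    fix x show "\<bar>v x\<bar> + norm (w x) \<le> 2 * t + ((v x)\<^sup>2 + (norm (w x))\<^sup>2) / t"
      using young[of "\<bar>v x\<bar>"] young[of "norm (w x)"] by (simp add: add_divide_distrib)
  qed
  also have "\<dots> = 2 * t * measure M (space M) + (LINT x|M. (v x)\<^sup>2 + (norm (w x))\<^sup>2) / t"
    using v w by simp
  finally show ?thesis .
qed

lemma H1_0_D:
  fixes u :: "'a::euclidean_space \<Rightarrow> real"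
  assumes B: "open B" and u: "u \<in> H1_0 B"
  shows "u \<in> borel_measurable (lebesgue_on B)" "integrable (lebesgue_on B) (\<lambda>x. (u x)\<^sup>2)"
    "has_weak_gradient B u (weak_grad B u)" "weak_grad B u \<in> borel_measurable (lebesgue_on B)"
    "integrable (lebesgue_on B) (\<lambda>x. (norm (weak_grad B u x))\<^sup>2)"
proof -
  show w: "has_weak_gradient B u (weak_grad B u)"
    using u by (auto simp: H1_0_def H1_def intro: has_weak_gradient_weak_grad)
  then show "weak_grad B u \<in> borel_measurable (lebesgue_on B)"
    by (auto simp: has_weak_gradient_def intro: locally_integrable_imp_measurable[OF B])
qed (use u in \<open>auto simp: H1_0_def H1_def set_integrable_lebesgue_on[OF B]\<close>)

lemma power2_norm_diff_le:
  fixes x y :: "'a::real_normed_vector"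
  shows "(norm (x - y))\<^sup>2 \<le> 2 * (norm x)\<^sup>2 + 2 * (norm y)\<^sup>2"
proof -
  have "(norm (x - y))\<^sup>2 \<le> (norm x + norm y)\<^sup>2"
    by (intro power_mono norm_triangle_ineq4) simp
  also have "\<dots> \<le> 2 * (norm x)\<^sup>2 + 2 * (norm y)\<^sup>2"
    using zero_le_power2[of "norm x - norm y"] by (simp add: power2_eq_square algebra_simps)
  finally show ?thesis .
qed

lemma integrable_square_diff:
  fixes f g :: "'a \<Rightarrow> 'b::{banach, second_countable_topology}"
  assumes [measurable]: "f \<in> borel_measurable M" "g \<in> borel_measurable M"
    and "integrable M (\<lambda>x. (norm (f x))\<^sup>2)" "integrable M (\<lambda>x. (norm (g x))\<^sup>2)"
  shows "integrable M (\<lambda>x. (norm (f x - g x))\<^sup>2)"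
proof (rule Bochner_Integration.integrable_bound)
  show "integrable M (\<lambda>x. 2 * (norm (f x))\<^sup>2 + 2 * (norm (g x))\<^sup>2)"
    using assms by simp
  show "AE x in M. norm ((norm (f x - g x))\<^sup>2) \<le> norm (2 * (norm (f x))\<^sup>2 + 2 * (norm (g x))\<^sup>2)"
    using power2_norm_diff_le by (intro AE_I2) auto
qed measurable

lemma test_grad_bounded:
  fixes \<psi> :: "'a::euclidean_space \<Rightarrow> real"
  assumes \<psi>: "\<psi> \<in> test_functions B"
  obtains M where "M > 0" "\<And>x. norm (test_grad \<psi> x) \<le> M"
proof -
  have "\<exists>M>0. \<forall>x. \<bar>frechet_derivative \<psi> (at x) i\<bar> \<le> M" if "i \<in> Basis" for i
    by (rule test_functions_bounded[OF test_functions_partial[OF \<psi> that]]) blast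
  then obtain M where M: "\<And>i. i \<in> Basis \<Longrightarrow> M i > 0"
    "\<And>i x. i \<in> Basis \<Longrightarrow> \<bar>frechet_derivative \<psi> (at x) i\<bar> \<le> M i"
    by metis
  have "norm (test_grad \<psi> x) \<le> (\<Sum>i\<in>Basis. M i)" for x
    by (rule order_trans[OF norm_le_l1]) (auto simp: test_grad_inner intro!: sum_mono M)
  moreover have "(\<Sum>i\<in>Basis. M i) > 0"
    by (rule sum_pos) (auto simp: M)
  ultimately show thesis
    using that by blast
qed

text \<open>For a fixed test function the failure of the product rule is a functional of the pair
  (function, gradient). It is linear, bounded in L1 because \<open>f\<close> and \<open>p\<close>
  are bounded, and zero on test functions, so it vanishes on their limits.\<close>

lemma has_weak_gradient_mult_H1_0:
  fixes f u :: "'a::euclidean_space \<Rightarrow> real" and p :: "'a \<Rightarrow> 'a"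
  assumes B: "open B" "bounded B" and f: "has_weak_gradient B f p"
    and F: "AE x in lebesgue_on B. \<bar>f x\<bar> \<le> F" and P: "AE x in lebesgue_on B. norm (p x) \<le> P"
    and u: "u \<in> H1_0 B"
  shows "has_weak_gradient B (\<lambda>x. f x * u x) (\<lambda>x. f x *\<^sub>R weak_grad B u x + u x *\<^sub>R p x)"
proof -
  define N where "N = lebesgue_on B"
  interpret N: finite_measure N
    unfolding N_def using B by (intro finite_measure_lebesgue_on lmeasurable_open)
  define w where "w = weak_grad B u"
  note uD = H1_0_D[OF B(1) u, folded N_def w_def]
  have lf: "locally_integrable B f" and lp: "locally_integrable B p"
    using f by (auto simp: has_weak_gradient_def)
  note [measurable] = uD(1,4) locally_integrable_imp_measurable[OF B(1) lf, folded N_def]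
    locally_integrable_imp_measurable[OF B(1) lp, folded N_def]
  have iu: "integrable N u" and iw: "integrable N w"
    using integrable_norm_if_integrable_square[OF N.finite_measure_axioms uD(1)]
      integrable_norm_if_integrable_square[OF N.finite_measure_axioms uD(4)] uD(2,5) by auto
  \<comment> \<open>Replacing the bounds by their maximum with 0 makes them nonnegative, as the
    monotonicity rules for products require.\<close>
  have F': "AE x in N. \<bar>f x\<bar> \<le> max F 0"
    using F unfolding N_def by eventually_elim simp
  have P': "AE x in N. norm (p x) \<le> max P 0"
    using P unfolding N_def by eventually_elim simp
  have ifv: "integrable N (\<lambda>x. f x * v x)" if "integrable N v" for v :: "'a \<Rightarrow> real"
    by (rule Bochner_Integration.integrable_bound[OF integrable_mult_right[OF that, of "max F 0"]])
      (use that F' in \<open>auto simp: abs_mult borel_measurable_integrable elim!: eventually_mono intro!: mult_right_mono\<close>)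
  have ifg: "integrable N (\<lambda>x. f x *\<^sub>R g x)" if "integrable N g" for g :: "'a \<Rightarrow> 'a"
    by (rule Bochner_Integration.integrable_bound[OF integrable_scaleR_right[OF that, of "max F 0"]])
      (use that F' in \<open>auto simp: borel_measurable_integrable elim!: eventually_mono intro!: mult_right_mono\<close>)
  have ivp: "integrable N (\<lambda>x. v x *\<^sub>R p x)" if "integrable N v" for v :: "'a \<Rightarrow> real"
    by (rule Bochner_Integration.integrable_bound[OF integrable_mult_right[OF that, of "max P 0"]])
      (use that P' in \<open>auto simp: abs_mult borel_measurable_integrable mult.commute elim!: eventually_mono intro!: mult_left_mono\<close>)
  obtain \<psi> where \<psi>: "\<And>k::nat. \<psi> k \<in> test_functions B"
    and lim: "(\<lambda>k. H1_norm B (\<lambda>x. u x - \<psi> k x)) \<longlonglongrightarrow> 0"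
    using u by (auto simp: H1_0_def)
  define v where "v k x = u x - \<psi> k x" for k x
  define y where "y k x = w x - test_grad (\<psi> k) x" for k x
  have i\<psi>: "integrable N (\<psi> k)" "integrable N (\<lambda>x. (\<psi> k x)\<^sup>2)" for k
  proof -
    obtain M where M: "M > 0" "\<And>x. \<bar>\<psi> k x\<bar> \<le> M"
      by (rule test_functions_bounded[OF \<psi>[of k]]) blast
    have m[measurable]: "\<psi> k \<in> borel_measurable N"
      unfolding N_def by (intro borel_measurable_lebesgue_onI borel_measurable_test_functions[OF \<psi>])
    show "integrable N (\<psi> k)"
      by (rule N.integrable_const_bound[of _ M]) (use M in auto)
    have "(\<psi> k x)\<^sup>2 \<le> M\<^sup>2" for x
      using power_mono[OF M(2)[of x], of 2] by simp
    then show "integrable N (\<lambda>x. (\<psi> k x)\<^sup>2)"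
      by (intro N.integrable_const_bound[of _ "M\<^sup>2"]) auto
  qed
  have itg: "integrable N (test_grad (\<psi> k))" "integrable N (\<lambda>x. (norm (test_grad (\<psi> k) x))\<^sup>2)" for k
  proof -
    obtain M where M: "M > 0" "\<And>x. norm (test_grad (\<psi> k) x) \<le> M"
      by (rule test_grad_bounded[OF \<psi>[of k]]) blast
    have m[measurable]: "test_grad (\<psi> k) \<in> borel_measurable N"
      using has_weak_gradient_test[OF B(1) \<psi>[of k]] unfolding N_def
      by (auto simp: has_weak_gradient_def intro: locally_integrable_imp_measurable[OF B(1)])
    show "integrable N (test_grad (\<psi> k))"
      by (rule N.integrable_const_bound[of _ M]) (use M in auto)
    have "(norm (test_grad (\<psi> k) x))\<^sup>2 \<le> M\<^sup>2" for x
      using power_mono[OF M(2)[of x], of 2] by simp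
    then show "integrable N (\<lambda>x. (norm (test_grad (\<psi> k) x))\<^sup>2)"
      by (intro N.integrable_const_bound[of _ "M\<^sup>2"]) auto
  qed
  have iv: "integrable N (v k)" "integrable N (\<lambda>x. (v k x)\<^sup>2)" for k
    using integrable_square_diff[of u N "\<psi> k"] iu i\<psi>[of k] uD
    by (auto simp: v_def[abs_def])
  have iy: "integrable N (y k)" "integrable N (\<lambda>x. (norm (y k x))\<^sup>2)" for k
    using integrable_square_diff[of w N "test_grad (\<psi> k)"] iw itg[of k] uD
    by (auto simp: y_def[abs_def])
  define r where "r k = H1_norm B (v k)" for k
  have r: "r \<longlonglongrightarrow> 0"
    using lim by (simp add: r_def[abs_def] v_def[abs_def])
  \<comment> \<open>\<open>H1_norm\<close> involves the representative chosen for the difference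
    \<open>v k\<close>, unrelated to those chosen for its parts; uniqueness identifies it almost
    everywhere with \<open>y k\<close>.\<close>
  have r2: "(LINT x|N. (v k x)\<^sup>2 + (norm (y k x))\<^sup>2) = (r k)\<^sup>2" for k
  proof -
    have "has_weak_gradient B (v k) (y k)"
      unfolding v_def[abs_def] y_def[abs_def] 
      by (intro has_weak_gradient_diff[OF B(1)] has_weak_gradient_test[OF B(1) \<psi>])
        (use uD in \<open>simp add: w_def\<close>)
    note g = weak_grad_eq[OF B(1) this] has_weak_gradient_weak_grad[OF this]
    have [measurable]: "weak_grad B (v k) \<in> borel_measurable N"
      using g(2) unfolding N_def
      by (auto simp: has_weak_gradient_def intro: locally_integrable_imp_measurable[OF B(1)])
    note [measurable] = borel_measurable_integrable[OF iv(1)] borel_measurable_integrable[OF iy(1)]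
    have "(LINT x|N. (v k x)\<^sup>2 + (norm (y k x))\<^sup>2) =
        (LINT x|N. (v k x)\<^sup>2 + (norm (weak_grad B (v k) x))\<^sup>2)"
    proof (rule integral_cong_AE)
      show "AE x in N. (v k x)\<^sup>2 + (norm (y k x))\<^sup>2 = (v k x)\<^sup>2 + (norm (weak_grad B (v k) x))\<^sup>2"
        using g(1) unfolding N_def by eventually_elim simp
    qed measurable
    also have "\<dots> = (r k)\<^sup>2"
      unfolding r_def H1_norm_def set_lebesgue_integral_lebesgue_on[OF B(1)] N_def[symmetric]
      by (subst real_sqrt_pow2) (auto intro!: integral_nonneg_AE)
    finally show ?thesis .
  qed
  have "(LINT x|N. f x * u x * frechet_derivative \<eta> (at x) i) =
      - (LINT x|N. (f x *\<^sub>R w x + u x *\<^sub>R p x) \<bullet> i * \<eta> x)"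
    if \<eta>: "\<eta> \<in> test_functions B" and i: "i \<in> Basis" for \<eta> i
  proof -
    define dx where "dx x = frechet_derivative \<eta> (at x) i" for x
    \<comment> \<open>The defect: its integral is zero exactly when the product rule holds for
      \<open>v\<close>, with gradient \<open>g\<close>, against the test function
      \<open>\<eta>\<close>.\<close>
    define E where "E v g x = f x * v x * dx x + (f x *\<^sub>R g x + v x *\<^sub>R p x) \<bullet> i * \<eta> x"
      for v :: "'a \<Rightarrow> real" and g :: "'a \<Rightarrow> 'a" and x
    have dx: "dx \<in> test_functions B"
      unfolding dx_def[abs_def] by (rule test_functions_partial[OF \<eta> i])
    obtain M1 where M1: "M1 > 0" "\<And>x. \<bar>\<eta> x\<bar> \<le> M1"
      by (rule test_functions_bounded[OF \<eta>]) blast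
    obtain M2 where M2: "M2 > 0" "\<And>x. \<bar>dx x\<bar> \<le> M2"
      by (rule test_functions_bounded[OF dx]) blast
    have [measurable]: "\<eta> \<in> borel_measurable N" "dx \<in> borel_measurable N"
      unfolding N_def by (auto intro!: borel_measurable_lebesgue_onI borel_measurable_test_functions \<eta> dx)
    have iE1: "integrable N (\<lambda>x. f x * v x * dx x)" if v: "integrable N v" for v
      by (rule Bochner_Integration.integrable_bound[OF integrable_mult_left[OF ifv[OF v], of M2]])
        (use M2 borel_measurable_integrable[OF v] in
          \<open>auto simp: abs_mult intro!: mult_left_mono\<close>)
    have iE2: "integrable N (\<lambda>x. (f x *\<^sub>R g x + v x *\<^sub>R p x) \<bullet> i * \<eta> x)"
      if v: "integrable N v" and g: "integrable N g" for v g
      by (rule Bochner_Integration.integrable_bound[OF integrable_mult_left[OF integrable_inner_left[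
            OF Bochner_Integration.integrable_add[OF ifg[OF g] ivp[OF v]], of i], of M1]])
        (use M1 borel_measurable_integrable[OF v] borel_measurable_integrable[OF g] in
          \<open>auto simp: abs_mult intro!: mult_left_mono\<close>)
    have iE: "integrable N (E v g)" if "integrable N v" "integrable N g" for v g
      unfolding E_def[abs_def] using iE1[OF that(1)] iE2[OF that]
      by (rule Bochner_Integration.integrable_add)
    have E0: "integral\<^sup>L N (E (\<psi> k) (test_grad (\<psi> k))) = 0" for k
      unfolding E_def Bochner_Integration.integral_add[OF iE1[OF i\<psi>(1)] iE2[OF i\<psi>(1) itg(1)]]
      using has_weak_gradient_integral[OF B(1) has_weak_gradient_mult_test[OF B(1) f \<psi>[of k]] \<eta> i]
      by (simp add: N_def dx_def)
    \<comment> \<open>One summand for each of the three products in \<open>E\<close>, so that a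
      single constant serves both the function and its gradient.\<close>
    define C where "C = max F 0 * M2 + max F 0 * M1 + max P 0 * M1"
    have C: "C \<ge> 0"
      using M1 M2 by (simp add: C_def)
    have Ebound: "\<bar>integral\<^sup>L N (E v g)\<bar> \<le> C * (LINT x|N. \<bar>v x\<bar> + norm (g x))"
      if v: "integrable N v" and g: "integrable N g" for v g
    proof -
      have "\<bar>integral\<^sup>L N (E v g)\<bar> \<le> (LINT x|N. \<bar>E v g x\<bar>)"
        by (rule integral_abs_bound)
      also have "\<dots> \<le> (LINT x|N. C * (\<bar>v x\<bar> + norm (g x)))"
      proof (rule integral_mono_AE)
        show "integrable N (\<lambda>x. \<bar>E v g x\<bar>)"
          using iE[OF v g] by simp
        show "integrable N (\<lambda>x. C * (\<bar>v x\<bar> + norm (g x)))"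
          using v g by simp
        show "AE x in N. \<bar>E v g x\<bar> \<le> C * (\<bar>v x\<bar> + norm (g x))"
          using F' P'
        proof eventually_elim
          case (elim x)
          have "\<bar>f x * v x * dx x\<bar> \<le> max F 0 * \<bar>v x\<bar> * M2"
            unfolding abs_mult using elim M2 by (intro mult_mono) auto
          moreover have "\<bar>(f x *\<^sub>R g x + v x *\<^sub>R p x) \<bullet> i * \<eta> x\<bar> \<le>
              (max F 0 * norm (g x) + \<bar>v x\<bar> * max P 0) * M1"
          proof -
            have "\<bar>(f x *\<^sub>R g x + v x *\<^sub>R p x) \<bullet> i\<bar> \<le> norm (f x *\<^sub>R g x + v x *\<^sub>R p x)"
              by (rule Basis_le_norm[OF i])
            also have "\<dots> \<le> \<bar>f x\<bar> * norm (g x) + \<bar>v x\<bar> * norm (p x)"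
              by (rule norm_triangle_le) simp
            also have "\<dots> \<le> max F 0 * norm (g x) + \<bar>v x\<bar> * max P 0"
              using elim by (intro add_mono mult_right_mono mult_left_mono) auto
            finally show ?thesis
              unfolding abs_mult using M1 by (intro mult_mono) auto
          qed
          moreover have "max F 0 * \<bar>v x\<bar> * M2 + (max F 0 * norm (g x) + \<bar>v x\<bar> * max P 0) * M1 \<le>
              C * (\<bar>v x\<bar> + norm (g x))"
          proof -
            have "0 \<le> max F 0 * M2 * norm (g x)" "0 \<le> max F 0 * M1 * \<bar>v x\<bar>" "0 \<le> max P 0 * M1 * norm (g x)"
              using M1 M2 by auto
            then show ?thesis
              by (simp add: C_def algebra_simps del: mult_nonneg_nonneg)
          qed
          ultimately show ?case
            unfolding E_def by linarith
        qed
      qed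
      finally show ?thesis
        by simp
    qed
    define e where "e = \<bar>integral\<^sup>L N (E u w)\<bar>"
    \<comment> \<open>By linearity, subtracting the zero defect of \<open>\<psi> k\<close> leaves
      the defect of the approximation error.\<close>
    have eq: "integral\<^sup>L N (E u w) = integral\<^sup>L N (E (v k) (y k))" for k
    proof -
      have "integral\<^sup>L N (E (v k) (y k)) = (LINT x|N. E u w x - E (\<psi> k) (test_grad (\<psi> k)) x)"
        by (rule Bochner_Integration.integral_cong)
          (auto simp: E_def v_def y_def algebra_simps inner_add_left inner_diff_left scaleR_diff_right
            scaleR_diff_left)
      also have "\<dots> = integral\<^sup>L N (E u w) - integral\<^sup>L N (E (\<psi> k) (test_grad (\<psi> k)))"
        by (rule Bochner_Integration.integral_diff[OF iE[OF iu iw] iE[OF i\<psi>(1) itg(1)]])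
      finally show ?thesis
        using E0 by simp
    qed
    have le: "e \<le> C * (2 * t * measure N (space N) + (r k)\<^sup>2 / t)" if "t > 0" for t k
    proof -
      have "e \<le> C * (LINT x|N. \<bar>v k x\<bar> + norm (y k x))"
        unfolding e_def eq[of k] by (rule Ebound[OF iv(1) iy(1)])
      also have "\<dots> \<le> C * (2 * t * measure N (space N) + (r k)\<^sup>2 / t)"
        unfolding r2[symmetric]
        by (intro mult_left_mono C integral_norm_le_Young N.finite_measure_axioms iv iy that)
      finally show ?thesis .
    qed
    \<comment> \<open>The limits are taken in turn: k tends to infinity for fixed t, which removes
      the quotient by t; only afterwards does t tend to 0.\<close>
    have le2: "e \<le> C * (2 * t * measure N (space N))" if t: "t > 0" for t
    proof (rule tendsto_lowerbound)
      show "(\<lambda>k. C * (2 * t * measure N (space N) + (r k)\<^sup>2 / t)) \<longlonglongrightarrow> C * (2 * t * measure N (space N))"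
        using tendsto_mult[OF tendsto_const[of C] tendsto_add[OF tendsto_const tendsto_divide[OF tendsto_power[OF r, of 2] tendsto_const[of t]]],
            of "2 * t * measure N (space N)"] t by simp
      show "\<forall>\<^sub>F k in sequentially. e \<le> C * (2 * t * measure N (space N) + (r k)\<^sup>2 / t)"
        using le[OF t] by simp
    qed simp
    have "e \<le> 0"
    proof (rule tendsto_lowerbound)
      show "(\<lambda>n. C * (2 * inverse (real (Suc n)) * measure N (space N))) \<longlonglongrightarrow> 0"
        using tendsto_mult[OF LIMSEQ_inverse_real_of_nat tendsto_const[of "C * 2 * measure N (space N)"]]
        by (simp add: mult_ac)
      show "\<forall>\<^sub>F n in sequentially. e \<le> C * (2 * inverse (real (Suc n)) * measure N (space N))"
        using le2 by simp
    qed simp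
    then have "integral\<^sup>L N (E u w) = 0"
      by (simp add: e_def)
    then show ?thesis
      unfolding E_def Bochner_Integration.integral_add[OF iE1[OF iu] iE2[OF iu iw]]
      by (simp add: dx_def)
  qed
  moreover have "locally_integrable B (\<lambda>x. f x * u x)"
    using ifv[OF iu] unfolding N_def
    by (intro set_integrable_imp_locally_integrable) (simp add: set_integrable_lebesgue_on[OF B(1)])
  moreover have "locally_integrable B (\<lambda>x. f x *\<^sub>R w x + u x *\<^sub>R p x)"
    using ifg[OF iw] ivp[OF iu] unfolding N_def
    by (intro set_integrable_imp_locally_integrable) (simp add: set_integrable_lebesgue_on[OF B(1)])
  ultimately show ?thesis
    by (simp add: has_weak_gradient_def set_lebesgue_integral_lebesgue_on[OF B(1)] N_def w_def)
qed

subsection \<open>The phase field and coercivity\<close>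

text \<open>On one side of the boundary this is the Lipschitz bound for \<open>infdist\<close>.
  Between points on opposite sides the segment meets the frontier, so the two distances, which add
  up because of the signs, are together at most the length of the segment.\<close>

lemma lipschitz_signed_dist: "1-lipschitz_on UNIV (signed_dist \<Omega>)"
proof (rule lipschitz_onI)
  let ?i = "\<lambda>x. infdist x (frontier \<Omega>)"
  have crossing: "?i x + ?i y \<le> dist x y" if "x \<in> \<Omega>" "y \<notin> \<Omega>" for x y
  proof -
    have "closed_segment x y \<inter> frontier \<Omega> \<noteq> {}"
      using that by (intro connected_Int_frontier) auto
    then obtain z where z: "z \<in> closed_segment x y" "z \<in> frontier \<Omega>"
      by auto
    have "dist x y = dist x z + dist z y"
      using z(1) by (metis between between_mem_segment)
    then show ?thesis
      using infdist_le[OF z(2), of x] infdist_le[OF z(2), of y] by (simp add: dist_commute)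
  qed
  show "dist (signed_dist \<Omega> x) (signed_dist \<Omega> y) \<le> 1 * dist x y" for x y
    using crossing[of x y] crossing[of y x] infdist_triangle_abs[of x "frontier \<Omega>" y]
      infdist_nonneg[of x "frontier \<Omega>"] infdist_nonneg[of y "frontier \<Omega>"]
    by (auto simp: signed_dist_def dist_real_def dist_commute[of x y] abs_minus_commute)
qed simp

lemma lipschitz_tanh: "1-lipschitz_on UNIV (tanh :: real \<Rightarrow> real)"
proof (rule lipschitz_onI)
  fix x y :: real
  have "norm (tanh x - tanh y) \<le> 1 * norm (x - y)"
  proof (rule field_differentiable_bound[of UNIV tanh "\<lambda>x. 1 - (tanh x)\<^sup>2"])
    show "(tanh has_field_derivative 1 - (tanh z)\<^sup>2) (at z)" for z :: real
      using cosh_real_pos[of z] by (auto intro!: derivative_eq_intros)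
    show "norm (1 - (tanh z)\<^sup>2) \<le> 1" for z :: real
      using tanh_real_bounds[of z] abs_square_le_1[of "tanh z"] zero_le_power2[of "tanh z"]
      by (simp add: abs_le_iff)
  qed auto
  then show "dist (tanh x) (tanh y) \<le> 1 * dist x y"
    by (simp add: dist_norm)
qed simp

text \<open>The constant is the product of the outer factor 1/2, the inner factor
  3/\<open>\<epsilon>\<close>, and the Lipschitz constants 1 of tanh and of the signed
  distance.\<close>

lemma lipschitz_phase_field:
  assumes "\<epsilon> > 0"
  shows "(3 / (2 * \<epsilon>))-lipschitz_on UNIV (phase_field \<Omega> \<epsilon>)"
proof (rule lipschitz_onI)
  fix x y
  have "phase_field \<Omega> \<epsilon> x - phase_field \<Omega> \<epsilon> y =
      - (1 / 2) * (tanh (3 * signed_dist \<Omega> x / \<epsilon>) - tanh (3 * signed_dist \<Omega> y / \<epsilon>))"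
    unfolding phase_field_def by (simp add: diff_divide_distrib)
  then have "\<bar>phase_field \<Omega> \<epsilon> x - phase_field \<Omega> \<epsilon> y\<bar> =
      1 / 2 * dist (tanh (3 * signed_dist \<Omega> x / \<epsilon>)) (tanh (3 * signed_dist \<Omega> y / \<epsilon>))"
    by (simp add: dist_real_def)
  also have "\<dots> \<le> 1 / 2 * dist (3 * signed_dist \<Omega> x / \<epsilon>) (3 * signed_dist \<Omega> y / \<epsilon>)"
    using lipschitz_onD[OF lipschitz_tanh] by simp
  also have "\<dots> = 3 / (2 * \<epsilon>) * dist (signed_dist \<Omega> x) (signed_dist \<Omega> y)"
  proof -
    have "3 * signed_dist \<Omega> x / \<epsilon> - 3 * signed_dist \<Omega> y / \<epsilon> =
        3 / \<epsilon> * (signed_dist \<Omega> x - signed_dist \<Omega> y)"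
      by (simp add: diff_divide_distrib right_diff_distrib)
    then have "\<bar>3 * signed_dist \<Omega> x / \<epsilon> - 3 * signed_dist \<Omega> y / \<epsilon>\<bar> =
        3 / \<epsilon> * \<bar>signed_dist \<Omega> x - signed_dist \<Omega> y\<bar>"
      using assms by (simp only: abs_mult) simp
    then show ?thesis
      unfolding dist_real_def using assms by simp
  qed
  also have "\<dots> \<le> 3 / (2 * \<epsilon>) * dist x y"
    using lipschitz_onD[OF lipschitz_signed_dist, of x y \<Omega>] assms by (intro mult_left_mono) auto
  finally show "dist (phase_field \<Omega> \<epsilon> x) (phase_field \<Omega> \<epsilon> y) \<le> 3 / (2 * \<epsilon>) * dist x y"
    by (simp add: dist_real_def)
qed (use assms in simp)

lemma phase_field_bounds: "0 < phase_field \<Omega> \<epsilon> x" "phase_field \<Omega> \<epsilon> x < 1"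
  using tanh_real_bounds[of "3 * signed_dist \<Omega> x / \<epsilon>"] by (auto simp: phase_field_def)

lemma GDERIV_phase_field:
  assumes g: "GDERIV (signed_dist \<Omega>) x :> g" and "\<epsilon> > 0"
  shows "GDERIV (phase_field \<Omega> \<epsilon>) x :>
    (- (6 / \<epsilon> * phase_field \<Omega> \<epsilon> x * (1 - phase_field \<Omega> \<epsilon> x))) *\<^sub>R g"
proof -
  define s where "s = signed_dist \<Omega> x"
  have "((\<lambda>t. 1 / 2 * (1 - tanh (3 * t / \<epsilon>))) has_real_derivative
      - (3 / (2 * \<epsilon>) * (1 - (tanh (3 * s / \<epsilon>))\<^sup>2))) (at s)"
    using cosh_real_pos[of "3 * s / \<epsilon>"] \<open>\<epsilon> > 0\<close>
    by (auto intro!: derivative_eq_intros simp: diff_divide_distrib)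
  from GDERIV_DERIV_compose[OF g, folded s_def, OF this]
  have "GDERIV (phase_field \<Omega> \<epsilon>) x :> (- (3 / (2 * \<epsilon>) * (1 - (tanh (3 * s / \<epsilon>))\<^sup>2))) *\<^sub>R g"
    by (simp add: phase_field_def[abs_def])
  \<comment> \<open>The value of tanh here is 1 - 2 \<open>\<phi>\<close>, and 1 - (1 - 2
    \<open>\<phi>\<close>)^2 = 4 \<open>\<phi>\<close> (1 - \<open>\<phi>\<close>).\<close>
  moreover have "1 - (tanh (3 * s / \<epsilon>))\<^sup>2 = 4 * (phase_field \<Omega> \<epsilon> x * (1 - phase_field \<Omega> \<epsilon> x))"
    unfolding phase_field_def s_def[symmetric] by (simp add: power2_eq_square algebra_simps)
  then have "3 / (2 * \<epsilon>) * (1 - (tanh (3 * s / \<epsilon>))\<^sup>2) =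
      6 / \<epsilon> * phase_field \<Omega> \<epsilon> x * (1 - phase_field \<Omega> \<epsilon> x)"
    by simp
  ultimately show ?thesis
    by (simp only:)
qed

lemma phase_field_weak_gradient:
  assumes B: "open B" and \<epsilon>: "\<epsilon> > 0"
    and ae: "AE x in lebesgue_on B. \<exists>g. GDERIV (signed_dist \<Omega>) x :> g \<and> norm g = 1"
  obtains p where "has_weak_gradient B (phase_field \<Omega> \<epsilon>) p"
    "AE x in lebesgue_on B. norm (p x) = 6 / \<epsilon> * phase_field \<Omega> \<epsilon> x * (1 - phase_field \<Omega> \<epsilon> x)"
proof -
  \<comment> \<open>The hypothesis gives a unit gradient pointwise, so a field is chosen; its
    measurability comes later from the difference quotients.\<close>
  define n where "n x = (SOME g. GDERIV (signed_dist \<Omega>) x :> g \<and> norm g = 1)" for x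
  have n: "AE x in lebesgue_on B. GDERIV (signed_dist \<Omega>) x :> n x \<and> norm (n x) = 1"
    using ae unfolding n_def by eventually_elim (rule someI_ex)
  define p where "p x = (- (6 / \<epsilon> * phase_field \<Omega> \<epsilon> x * (1 - phase_field \<Omega> \<epsilon> x))) *\<^sub>R n x" for x
  have "AE x in lebesgue_on B. GDERIV (phase_field \<Omega> \<epsilon>) x :> p x"
    using n
  proof eventually_elim
    case (elim x)
    then show ?case
      unfolding p_def by (intro GDERIV_phase_field \<epsilon>) simp
  qed
  then have "has_weak_gradient B (phase_field \<Omega> \<epsilon>) p"
    by (rule lipschitz_has_weak_gradient[OF B lipschitz_phase_field[OF \<epsilon>]])
  moreover have "AE x in lebesgue_on B. norm (p x) = 6 / \<epsilon> * phase_field \<Omega> \<epsilon> x * (1 - phase_field \<Omega> \<epsilon> x)"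
    using n
  proof eventually_elim
    case (elim x)
    then show ?case
      using \<epsilon> phase_field_bounds[of \<Omega> \<epsilon> x] by (simp add: p_def abs_mult)
  qed
  ultimately show thesis
    using that by blast
qed

text \<open>To be used with a = \<open>\<phi>\<close> w and b = u p. Writing a as a difference gives
  |a|^2 at most 2 |a + 3/2 b|^2 + 2 (9/4) |b|^2, and 2 (9/4) 36 = 162; the added Y makes
  163.\<close>

lemma pf_integrand_coercive:
  fixes a b :: "'a::real_normed_vector"
  assumes "(norm b)\<^sup>2 \<le> 36 * Y"
  shows "1 / 163 * ((norm a)\<^sup>2 + Y) \<le> (norm (a + (3 / 2) *\<^sub>R b))\<^sup>2 + Y"
proof -
  have "(norm a)\<^sup>2 \<le> 2 * (norm (a + (3 / 2) *\<^sub>R b))\<^sup>2 + 2 * (norm ((3 / 2) *\<^sub>R b))\<^sup>2"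
    using power2_norm_diff_le[of "a + (3 / 2) *\<^sub>R b" "(3 / 2) *\<^sub>R b"] by simp
  also have "(norm ((3 / 2) *\<^sub>R b))\<^sup>2 = 9 / 4 * (norm b)\<^sup>2"
    by (simp add: power_mult_distrib power2_eq_square)
  finally show ?thesis
    using assms zero_le_power2[of "norm (a + (3 / 2) *\<^sub>R b)"] by argo
qed

theorem theorem4p1:
  fixes \<Omega> B :: "(real ^ 'n) set"
    and D :: "real ^ 'n \<Rightarrow> real"
    and \<epsilon> d :: real
  assumes "bounded_domain \<Omega>" and "C_k_boundary 1 \<Omega>"
    and "bounded_domain B" and "\<Omega> \<subseteq> B"
    and "AE x in lebesgue_on B. \<exists>g. GDERIV (signed_dist \<Omega>) x :> g \<and> norm g = 1"
    and "\<epsilon> > 0"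
    and "D \<in> borel_measurable (lebesgue_on B)" and "bounded (D ` B)"
    and "d > 0" and "\<And>x. x \<in> B \<Longrightarrow> D x \<ge> d"
  shows "\<exists>C>0. \<forall>u\<in>H1_0 B.
           pf_form B D (phase_field \<Omega> \<epsilon>) \<epsilon> u u \<ge> C * (pf_norm B (phase_field \<Omega> \<epsilon>) \<epsilon> u)\<^sup>2"
proof (intro exI[of _ "d / 163"] conjI ballI)
  show "d / 163 > 0"
    using assms(9) by simp
  fix u assume u: "u \<in> H1_0 B"
  have B: "open B" "bounded B"
    using assms(3) by (auto simp: bounded_domain_def)
  define \<phi> where "\<phi> = phase_field \<Omega> \<epsilon>"
  define N where "N = lebesgue_on B"
  define w where "w = weak_grad B u"
  define Y where "Y x = 1 / \<epsilon>\<^sup>2 * (1 - \<phi> x)\<^sup>2 * (u x)\<^sup>2" for x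
  have \<phi>: "0 < \<phi> x" "\<phi> x < 1" for x
    unfolding \<phi>_def by (rule phase_field_bounds)+
  obtain p where p: "has_weak_gradient B \<phi> p"
    and np: "AE x in N. norm (p x) = 6 / \<epsilon> * \<phi> x * (1 - \<phi> x)"
    using phase_field_weak_gradient[OF B(1) assms(6,5)] unfolding \<phi>_def N_def by blast
  \<comment> \<open>A crude bound, enough for the product rule and for integrability. The coercivity
    estimate uses the exact value \<open>np\<close>.\<close>
  have p_le: "AE x in N. norm (p x) \<le> 6 / \<epsilon>"
    using np
  proof eventually_elim
    case (elim x)
    have "\<phi> x * (1 - \<phi> x) \<le> 1 * 1"
      using \<phi>[of x] by (intro mult_mono) auto
    then have "6 / \<epsilon> * (\<phi> x * (1 - \<phi> x)) \<le> 6 / \<epsilon> * (1 * 1)"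
      using assms(6) by (intro mult_left_mono) auto
    with elim show ?case by simp
  qed
  have W: "has_weak_gradient B (\<lambda>x. \<phi> x * u x) (\<lambda>x. \<phi> x *\<^sub>R w x + u x *\<^sub>R p x)"
    unfolding w_def
    by (rule has_weak_gradient_mult_H1_0[OF B p _ p_le[unfolded N_def] u, of 1])
      (use \<phi> in \<open>auto simp: less_imp_le abs_of_pos\<close>)
  note uD = H1_0_D[OF B(1) u, folded N_def w_def]
  have meas: "g \<in> borel_measurable N" if "has_weak_gradient B f g" for f g
    using that unfolding N_def
    by (auto simp: has_weak_gradient_def intro: locally_integrable_imp_measurable[OF B(1)])
  have [measurable]: "\<phi> \<in> borel_measurable N"
    using p unfolding N_def
    by (auto simp: has_weak_gradient_def intro: locally_integrable_imp_measurable[OF B(1)])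
  note [measurable] = uD(1,4) meas[OF has_weak_gradient_weak_grad[OF W]]
    meas[OF has_weak_gradient_weak_grad[OF p]] assms(7)[folded N_def]
  define F where "F x =
      D x * (weak_grad B (\<lambda>y. \<phi> y * u y) x \<bullet>
        (weak_grad B (\<lambda>y. \<phi> y * u y) x + u x *\<^sub>R weak_grad B \<phi> x))
      + D x / \<epsilon>\<^sup>2 * (1 - \<phi> x)\<^sup>2 * u x * u x
      + D x / 4 * (norm (weak_grad B \<phi> x))\<^sup>2 * u x * u x" for x
  define S where "S x = (norm (\<phi> x *\<^sub>R w x + (3 / 2) *\<^sub>R (u x *\<^sub>R p x)))\<^sup>2 + Y x" for x
  have Y: "Y x \<ge> 0" for x
    by (simp add: Y_def)
  then have S: "S x \<ge> 0" for x
    by (simp add: S_def)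
  have F_eq: "AE x in N. F x = D x * S x"
    using weak_grad_eq[OF B(1) W, folded N_def] weak_grad_eq[OF B(1) p, folded N_def]
  proof eventually_elim
    case (elim x)
    \<comment> \<open>The weak gradient of \<open>\<phi>\<close> u. The mixed term of the form
      contributes X . (u p), the cross term of |X + (u/2) p|^2, and the summand with
      \<open>D / 4\<close> contributes the remaining square.\<close>
    define X where "X = \<phi> x *\<^sub>R w x + u x *\<^sub>R p x"
    have "\<phi> x *\<^sub>R w x + (3 / 2) *\<^sub>R (u x *\<^sub>R p x) = X + (u x / 2) *\<^sub>R p x"
      unfolding X_def by (simp add: add.assoc flip: scaleR_left_distrib)
    moreover have "(norm (X + (u x / 2) *\<^sub>R p x))\<^sup>2 = X \<bullet> (X + u x *\<^sub>R p x) + (norm (p x))\<^sup>2 / 4 * u x * u x"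
      unfolding power2_norm_eq_inner
      by (simp add: inner_add_left inner_add_right inner_commute[of "p x" X]) (simp add: algebra_simps add_divide_distrib)
    ultimately have "S x = X \<bullet> (X + u x *\<^sub>R p x) + (norm (p x))\<^sup>2 / 4 * u x * u x + Y x"
      by (simp add: S_def)
    then show ?case
      unfolding F_def Y_def elim X_def[symmetric] by (simp add: power2_eq_square distrib_left)
  qed
  obtain K where K: "\<And>x. x \<in> B \<Longrightarrow> \<bar>D x\<bar> \<le> K"
    using assms(8) unfolding bounded_iff by auto
  have space: "AE x in N. x \<in> B"
    using AE_space[of N] by (simp add: N_def)
  \<comment> \<open>Without this the form could take the default value 0, and the final comparison
    of integrals would fail.\<close>
  have int: "integrable N F"
  proof (rule Bochner_Integration.integrable_bound)
    show "integrable N (\<lambda>x. K * (2 * (norm (w x))\<^sup>2 + 163 / \<epsilon>\<^sup>2 * (u x)\<^sup>2))"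
      using uD by simp
    show "F \<in> borel_measurable N"
      unfolding F_def[abs_def] by measurable
    show "AE x in N. norm (F x) \<le> norm (K * (2 * (norm (w x))\<^sup>2 + 163 / \<epsilon>\<^sup>2 * (u x)\<^sup>2))"
      using F_eq space p_le
    proof eventually_elim
      case (elim x)
      define Z where "Z = (3 / 2) *\<^sub>R (u x *\<^sub>R p x)"
      define c where "c = (u x)\<^sup>2 / \<epsilon>\<^sup>2"
      have "(norm (\<phi> x *\<^sub>R w x + Z))\<^sup>2 \<le> 2 * (norm (\<phi> x *\<^sub>R w x))\<^sup>2 + 2 * (norm Z)\<^sup>2"
        using power2_norm_diff_le[of "\<phi> x *\<^sub>R w x" "- Z"] by simp
      moreover have "(norm (\<phi> x *\<^sub>R w x))\<^sup>2 \<le> (norm (w x))\<^sup>2"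
        using \<phi>[of x] by (intro power_mono) (auto simp: mult_left_le_one_le)
      moreover have "(norm Z)\<^sup>2 \<le> 81 * c"
      proof -
        have "norm Z \<le> \<bar>3 / 2\<bar> * (\<bar>u x\<bar> * (6 / \<epsilon>))"
          unfolding Z_def norm_scaleR using elim(3) by (intro mult_mono) auto
        then have "(norm Z)\<^sup>2 \<le> (\<bar>3 / 2\<bar> * (\<bar>u x\<bar> * (6 / \<epsilon>)))\<^sup>2"
          by (intro power_mono) auto
        then show ?thesis
          by (simp add: c_def power_mult_distrib power_divide)
      qed
      moreover have "Y x \<le> c"
        unfolding Y_def c_def using \<phi>[of x] by (simp add: divide_right_mono mult_left_le_one_le power_le_one)
      \<comment> \<open>Here 81 is the square of (3/2) 6, and 2 * 81 + 1 = 163.\<close>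
      ultimately have "S x \<le> 2 * (norm (w x))\<^sup>2 + 163 * c"
        unfolding S_def Z_def[symmetric] by linarith
      then have "S x \<le> 2 * (norm (w x))\<^sup>2 + 163 / \<epsilon>\<^sup>2 * (u x)\<^sup>2"
        by (simp add: c_def)
      then have "\<bar>D x\<bar> * S x \<le> K * (2 * (norm (w x))\<^sup>2 + 163 / \<epsilon>\<^sup>2 * (u x)\<^sup>2)"
        using K[OF elim(2)] S[of x] by (intro mult_mono) auto
      then show ?case
        using elim(1) S[of x] order_trans[OF abs_ge_zero K[OF elim(2)]] by (simp add: abs_mult)
    qed
  qed
  have le: "AE x in N. d / 163 * ((\<phi> x)\<^sup>2 * (norm (w x))\<^sup>2 + Y x) \<le> F x"
    using F_eq space np
  proof eventually_elim
    case (elim x)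
    \<comment> \<open>The factor 1 - \<open>\<phi>\<close> in p is the one that \<open>Y\<close>
      carries, so the cross term is controlled even where \<open>\<phi>\<close> is close to 1 and
      \<open>Y\<close> degenerates.\<close>
    have "(norm (u x *\<^sub>R p x))\<^sup>2 = 36 * Y x * (\<phi> x)\<^sup>2"
      unfolding norm_scaleR elim(3) Y_def by (simp add: power_mult_distrib power_divide)
    also have "\<dots> \<le> 36 * Y x * 1"
      using \<phi>[of x] Y[of x] by (intro mult_left_mono) (auto simp: power_le_one)
    finally have "1 / 163 * ((norm (\<phi> x *\<^sub>R w x))\<^sup>2 + Y x) \<le> S x"
      unfolding S_def by (intro pf_integrand_coercive) simp
    then have "d * (1 / 163 * ((norm (\<phi> x *\<^sub>R w x))\<^sup>2 + Y x)) \<le> D x * S x"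
      using assms(9) assms(10)[OF elim(2)] Y[of x] by (intro mult_mono) auto
    then show ?case
      unfolding elim(1) by (simp add: power_mult_distrib)
  qed
  have "d / 163 * (pf_norm B \<phi> \<epsilon> u)\<^sup>2 = d / 163 * (LINT x|N. (\<phi> x)\<^sup>2 * (norm (w x))\<^sup>2 + Y x)"
    unfolding pf_norm_def set_lebesgue_integral_lebesgue_on[OF B(1)] N_def[symmetric] w_def[symmetric]
    by (subst real_sqrt_pow2) (auto simp: Y_def intro!: integral_nonneg_AE)
  also have "\<dots> = (LINT x|N. d / 163 * ((\<phi> x)\<^sup>2 * (norm (w x))\<^sup>2 + Y x))"
    by simp
  \<comment> \<open>This form of monotonicity asks integrability only of the larger function: if the
    smaller one were not integrable, its integral would be 0, and \<open>F\<close> is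
    nonnegative.\<close>
  also have "\<dots> \<le> integral\<^sup>L N F"
  proof (rule integral_mono_AE'[OF int le])
    show "AE x in N. 0 \<le> F x"
      using F_eq space
    proof eventually_elim
      case (elim x)
      then show ?case
        using S[of x] assms(9) assms(10)[of x] by simp
    qed
  qed
  also have "\<dots> = pf_form B D \<phi> \<epsilon> u u"
    unfolding pf_form_def set_lebesgue_integral_lebesgue_on[OF B(1)] N_def[symmetric] F_def by simp
  finally show "d / 163 * (pf_norm B (phase_field \<Omega> \<epsilon>) \<epsilon> u)\<^sup>2 \<le> pf_form B D (phase_field \<Omega> \<epsilon>) \<epsilon> u u"
    unfolding \<phi>_def .
qed

end
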